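(* Let $(Z_i)_{i\ge 1}$ be i.i.d. random vectors in $\mathbb{R}^d$ having a density $f$ on an open set $O\subset\mathbb{R}^d$, where $f$ is continuous and strictly positive on $O$. Let $K$ be a kernel on $\mathbb{R}^d$ with compact support and bounded variation. Let $(h_n)_{n\ge1}$ satisfy $0<h_n<1$, $h_n\downarrow 0$, $nh_n\uparrow\infty$ and $nh_n/\log n\to c$, where $0<c<\infty$. Let $H\subset O$ be a compact set with nonempty interior. Then, with probability one, there exist $\epsilon>0$ and $n_0$ such that for all $n\ge n_0$, $$\sup_{z\in H}|f_n(K,z,h_n)-f(z)|>\epsilon.$$
   Context: A kernel is an integrable function $K:\mathbb{R}^d\to\mathbb{R}$ with $\int K=1$. The kernel density (Parzen–Rosenblatt) estimator with kernel $K$ and bandwidth $h_n$ (where $h_n$ plays the role of a volume) is $$f_n(K,z,h_n)=\frac{1}{nh_n}\sum_{i=1}^n K\Big(\frac{z-Z_i}{h_n^{1/d}}\Big).$$ *)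

theory Defs
  imports "HOL-Probability.Probability"
begin

definition kde_kernel :: "(real ^ 'd \<Rightarrow> real) \<Rightarrow> bool" where
  "kde_kernel K \<longleftrightarrow> integrable lborel K \<and> integral\<^sup>L lborel K = 1"

definition compact_support :: "(real ^ 'd \<Rightarrow> real) \<Rightarrow> bool" where
  "compact_support K \<longleftrightarrow> compact (closure {x. K x \<noteq> 0})"

text \<open>
  The increment of \<open>g\<close> over the box with lower corner \<open>a\<close> and upper corner \<open>b\<close>: the alternating
  sum of \<open>g\<close> over the vertices, which is \<open>g b - g a\<close> in dimension one.
\<close>

definition box_increment :: "(real ^ 'd \<Rightarrow> real) \<Rightarrow> real ^ 'd \<Rightarrow> real ^ 'd \<Rightarrow> real" where
  "box_increment g a b =
     (\<Sum>S\<in>UNIV. (- 1) ^ card S * g (\<chi> i. if i \<in> S then a $ i else b $ i))"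

text \<open>
  Bounded variation on the whole space in the sense of Vitali. For compactly supported functions
  this agrees with the sense of Hardy and Krause: the variations over coordinate
  faces are controlled by the variation over a box whose opposite face misses the support.
  Degenerate cells of a division are harmless, since their increments vanish.
\<close>

definition bounded_variation :: "(real ^ 'd \<Rightarrow> real) \<Rightarrow> bool" where
  "bounded_variation g \<longleftrightarrow>
     (\<exists>B. \<forall>a b D. D division_of cbox a b \<longrightarrow>
        (\<Sum>C\<in>D. \<bar>box_increment g (interval_lowerbound C) (interval_upperbound C)\<bar>) \<le> B)"

text \<open>
  The law of \<open>X\<close> has density \<open>f\<close> on \<open>U\<close>. Nothing is required of the law outside \<open>U\<close>, where \<open>f\<close> is
  irrelevant; in particular the law may charge the complement of \<open>U\<close> in a singular way.
\<close>

definition has_density_on ::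
  "'a measure \<Rightarrow> ('a \<Rightarrow> real ^ 'd) \<Rightarrow> (real ^ 'd \<Rightarrow> real) \<Rightarrow> (real ^ 'd) set \<Rightarrow> bool" where
  "has_density_on M X f U \<longleftrightarrow>
     (\<forall>A\<in>sets borel. A \<subseteq> U \<longrightarrow>
        emeasure (distr M borel X) A = (\<integral>\<^sup>+x\<in>A. ennreal (f x) \<partial>lborel))"

definition kde ::
  "(real ^ 'd \<Rightarrow> real) \<Rightarrow> (nat \<Rightarrow> real ^ 'd) \<Rightarrow> nat \<Rightarrow> real ^ 'd \<Rightarrow> real \<Rightarrow> real" where
  "kde K x n z h =
     1 / (real n * h) * (\<Sum>i=1..n. K ((z - x i) /\<^sub>R (h powr (1 / real CARD('d)))))"

end

theory Submission
  imports Defs "HOL-Real_Asymp.Real_Asymp"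
begin

text \<open>
  Why the estimate cannot converge uniformly when \<open>n * h n\<close> grows like \<open>c * ln n\<close>. Call the set
  of points within \<open>R * s\<close> of a centre \<open>z\<close> a cell, where \<open>s\<close> is the \<open>d\<close>-th root of the bandwidth
  \<open>h n\<close> and \<open>R\<close> bounds the support of \<open>K\<close>. A cell holds on average of the order of \<open>ln n\<close>
  observations, so an event that is exponentially unlikely in that number has a probability that is
  a negative power of \<open>n\<close>, whereas about \<open>n / ln n\<close> disjoint cells fit into the interior of \<open>H\<close>.
  Some of the cells must therefore behave atypically.

  The atypical event used here is a hole. Since \<open>K\<close> has integral \<open>1\<close>, there are sets \<open>A\<close> of
  arbitrarily small positive measure with \<open>\<theta> = \<integral>\<^sub>A K \<noteq> 0\<close> (\<open>small_set_carrying_mass\<close>). If no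
  observation falls into \<open>z - s *\<^sub>R A\<close> and the other observations behave normally, then the estimate
  at \<open>z\<close> is near \<open>f z * (1 - \<theta>)\<close> instead of \<open>f z\<close>. The probability of this is bounded below in
  \<open>cell_deviation_probability\<close>, through a second moment bound under avoidance
  (\<open>avoiding_concentration\<close>); it needs \<open>K\<close> to be bounded, which is what bounded variation supplies
  (\<open>bounded_variation_imp_bounded\<close>). A small enough \<open>A\<close> makes this probability at least of the
  order of \<open>n powr (- 1 / 10)\<close>.

  Cells are not independent for a sample of fixed size, but moving one observation affects at most
  two of them. McDiarmid's inequality (\<open>bounded_differences_lower_tail\<close>) hence bounds the
  probability that no cell deviates by \<open>exp (- \<kappa> * n powr (4 / 5) / (ln n)\<^sup>2)\<close> with some
  \<open>\<kappa> > 0\<close>. These bounds are summable and the Borel-Cantelli lemma concludes, with a deterministic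
  \<open>\<epsilon>\<close>.
\<close>

section \<open>Concentration under bounded differences\<close>

lemma (in prob_space) abs_expectation_le:
  fixes f :: "'a \<Rightarrow> real"
  assumes "\<And>x. x \<in> space M \<Longrightarrow> \<bar>f x\<bar> \<le> b"
  shows "\<bar>expectation f\<bar> \<le> b"
proof (cases "integrable M f")
  case True
  have "\<bar>expectation f\<bar> \<le> expectation (\<lambda>x. \<bar>f x\<bar>)"
    by (rule integral_abs_bound)
  also have "\<dots> \<le> expectation (\<lambda>x. b)"
    by (rule integral_mono) (use True assms in auto)
  finally show ?thesis by (simp add: prob_space)
next
  case False
  obtain x where "x \<in> space M" using not_empty by auto
  with assms have "0 \<le> b" by (smt (verit))
  with False show ?thesis by (simp add: not_integrable_integral_eq)
qed

lemma (in prob_space) exp_moment_bounded_deviation: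
  fixes f :: "'a \<Rightarrow> real"
  assumes [measurable]: "f \<in> borel_measurable M"
    and bd: "\<And>x. x \<in> space M \<Longrightarrow> \<bar>f x\<bar> \<le> c"
    and mean: "expectation f = 0" and "t > 0"
  shows "expectation (\<lambda>x. exp (t * f x)) \<le> exp (t\<^sup>2 * c\<^sup>2 / 2)"
proof -
  interpret interval_bounded_random_variable M f "- c" c
    by unfold_locales (use bd in \<open>auto intro!: AE_I2 simp: abs_le_iff minus_le_iff\<close>)
  have le: "nn_integral M (\<lambda>x. exp (t * f x)) \<le> ennreal (exp (t\<^sup>2 * c\<^sup>2 / 2))"
    using Hoeffdings_lemma_nn_integral_0[OF \<open>t > 0\<close> mean] by (simp add: power2_eq_square mult_ac)
  have "expectation (\<lambda>x. exp (t * f x)) = enn2real (nn_integral M (\<lambda>x. exp (t * f x)))"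
    by (rule integral_eq_nn_integral) auto
  also have "\<dots> \<le> exp (t\<^sup>2 * c\<^sup>2 / 2)"
    using le by (simp add: enn2real_leI)
  finally show ?thesis .
qed

text \<open>
  Integrating out one coordinate leaves a function \<open>G\<close> of the remaining ones that still has
  differences at most \<open>c\<close>, and given these the deviation \<open>G x - g (x(j := y))\<close> is centred and at
  most \<open>c\<close> in modulus, so by Hoeffding's lemma each coordinate contributes one factor.
\<close>

lemma mgf_bounded_differences:
  fixes \<mu> :: "'b measure" and g :: "('i \<Rightarrow> 'b) \<Rightarrow> real"
  assumes "prob_space \<mu>" and "finite I"
    and "g \<in> borel_measurable (PiM I (\<lambda>_. \<mu>))"
    and "\<And>x i y. x \<in> space (PiM I (\<lambda>_. \<mu>)) \<Longrightarrow> i \<in> I \<Longrightarrow> y \<in> space \<mu> \<Longrightarrow> \<bar>g x - g (x(i := y))\<bar> \<le> c"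
    and "\<And>x. x \<in> space (PiM I (\<lambda>_. \<mu>)) \<Longrightarrow> \<bar>g x\<bar> \<le> b"
    and "t > 0"
  shows "(\<integral>x. exp (t * (integral\<^sup>L (PiM I (\<lambda>_. \<mu>)) g - g x)) \<partial>PiM I (\<lambda>_. \<mu>))
           \<le> exp (real (card I) * (t\<^sup>2 * c\<^sup>2 / 2))"
  using assms(2,3,4,5)
proof (induction I arbitrary: g)
  case empty
  then show ?case
    by (simp add: PiM_empty lebesgue_integral_count_space_finite)
next
  case (insert j J)
  interpret mu: prob_space \<mu> by fact
  interpret prod: product_prob_space "\<lambda>_::'i. \<mu>" UNIV
    by unfold_locales
  let ?P = "PiM J (\<lambda>_. \<mu>)" and ?Q = "PiM (insert j J) (\<lambda>_. \<mu>)"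
  interpret P: prob_space ?P by (intro prob_space_PiM \<open>prob_space \<mu>\<close>)
  interpret Q: prob_space ?Q by (intro prob_space_PiM \<open>prob_space \<mu>\<close>)
  note [measurable] = insert.prems(1)
  have upd: "x(j := y) \<in> space ?Q" if "x \<in> space ?P" "y \<in> space \<mu>" for x y
    using that by (auto simp: space_PiM PiE_def extensional_def Pi_def)
  have upd': "x(i := y) \<in> space ?P" if "x \<in> space ?P" "y \<in> space \<mu>" "i \<in> J" for x y i
    using that by (auto simp: space_PiM PiE_def extensional_def Pi_def)
  have m2[measurable]: "(\<lambda>(x, y). g (x(j := y))) \<in> borel_measurable (?P \<Otimes>\<^sub>M \<mu>)"
    using measurable_compose[OF measurable_add_dim insert.prems(1)]
    by (simp add: case_prod_beta')
  have m1[measurable]: "(\<lambda>y. g (x(j := y))) \<in> borel_measurable \<mu>" if "x \<in> space ?P" for x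
    using measurable_compose[OF measurable_Pair1'[OF that] m2] by simp
  define G where "G = (\<lambda>x. \<integral>y. g (x(j := y)) \<partial>\<mu>)"
  have [measurable]: "G \<in> borel_measurable ?P"
    unfolding G_def by (rule mu.borel_measurable_lebesgue_integral) simp
  have intx: "integrable \<mu> (\<lambda>y. g (x(j := y)))" if "x \<in> space ?P" for x
    by (rule mu.integrable_const_bound[where B = b])
      (use that insert.prems(3) upd in \<open>auto intro!: AE_I2\<close>)
  have intg: "integrable ?Q g"
    by (rule Q.integrable_const_bound[where B = b]) (use insert.prems(3) in \<open>auto intro!: AE_I2\<close>)
  have Eg: "integral\<^sup>L ?Q g = integral\<^sup>L ?P G"
    unfolding G_def by (rule prod.product_integral_insert) (use insert intg in auto)
  have Gb: "\<bar>G x\<bar> \<le> b" if "x \<in> space ?P" for x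
    unfolding G_def by (rule mu.abs_expectation_le) (use that insert.prems(3) upd in auto)
  have EGb: "\<bar>integral\<^sup>L ?P G\<bar> \<le> b"
    by (rule P.abs_expectation_le) (use Gb in auto)
  let ?e = "exp (t\<^sup>2 * c\<^sup>2 / 2)"
  have inner: "(\<integral>y. exp (t * (integral\<^sup>L ?P G - g (x(j := y)))) \<partial>\<mu>)
      \<le> exp (t * (integral\<^sup>L ?P G - G x)) * ?e" if x: "x \<in> space ?P" for x
  proof -
    have dev: "\<bar>G x - g (x(j := y))\<bar> \<le> c" if y: "y \<in> space \<mu>" for y
    proof -
      have "G x - g (x(j := y)) = (\<integral>y'. g (x(j := y')) - g (x(j := y)) \<partial>\<mu>)"
        unfolding G_def using intx[OF x] by (simp add: mu.prob_space)
      also have "\<bar>\<dots>\<bar> \<le> c"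
      proof (rule mu.abs_expectation_le)
        fix y' assume y': "y' \<in> space \<mu>"
        show "\<bar>g (x(j := y')) - g (x(j := y))\<bar> \<le> c"
          using insert.prems(2)[OF upd[OF x y'] insertI1 y] by (simp only: fun_upd_upd)
      qed
      finally show ?thesis .
    qed
    have "(\<integral>y. exp (t * (integral\<^sup>L ?P G - g (x(j := y)))) \<partial>\<mu>)
        = (\<integral>y. exp (t * (integral\<^sup>L ?P G - G x)) * exp (t * (G x - g (x(j := y)))) \<partial>\<mu>)"
      by (simp add: exp_add[symmetric] algebra_simps)
    also have "\<dots> = exp (t * (integral\<^sup>L ?P G - G x)) * (\<integral>y. exp (t * (G x - g (x(j := y)))) \<partial>\<mu>)"
      by simp
    also have "\<dots> \<le> exp (t * (integral\<^sup>L ?P G - G x)) * ?e"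
    proof (rule mult_left_mono[OF mu.exp_moment_bounded_deviation])
      show "(\<integral>y. G x - g (x(j := y)) \<partial>\<mu>) = 0"
        using intx[OF x] by (simp add: G_def mu.prob_space)
    qed (use x dev \<open>t > 0\<close> in auto)
    finally show ?thesis .
  qed
  have GIH: "(\<integral>x. exp (t * (integral\<^sup>L ?P G - G x)) \<partial>?P) \<le> exp (real (card J) * (t\<^sup>2 * c\<^sup>2 / 2))"
  proof (rule insert.IH)
    fix x i y assume x: "x \<in> space ?P" and i: "i \<in> J" and y: "y \<in> space \<mu>"
    have ij: "i \<noteq> j" using i insert.hyps by auto
    have "G x - G (x(i := y)) = (\<integral>z. g (x(j := z)) - g (x(i := y, j := z)) \<partial>\<mu>)"
      unfolding G_def using intx[OF x] intx[OF upd'[OF x y i]] by simp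
    also have "\<bar>\<dots>\<bar> \<le> c"
    proof (rule mu.abs_expectation_le)
      fix z assume z: "z \<in> space \<mu>"
      show "\<bar>g (x(j := z)) - g (x(i := y, j := z))\<bar> \<le> c"
        using insert.prems(2)[OF upd[OF x z] insertI2[OF i] y] by (simp only: fun_upd_twist[OF ij])
    qed
    finally show "\<bar>G x - G (x(i := y))\<bar> \<le> c" .
  qed (use Gb in auto)
  have bnd: "exp (t * (E - a)) \<le> exp (t * (2 * b))" if "\<bar>E\<bar> \<le> b" "\<bar>a\<bar> \<le> b" for E a :: real
    using that \<open>t > 0\<close> by auto
  have "(\<integral>x. exp (t * (integral\<^sup>L ?Q g - g x)) \<partial>?Q)
      = (\<integral>x. (\<integral>y. exp (t * (integral\<^sup>L ?P G - g (x(j := y)))) \<partial>\<mu>) \<partial>?P)"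
    unfolding Eg
  proof (rule prod.product_integral_insert)
    show "integrable ?Q (\<lambda>x. exp (t * (integral\<^sup>L ?P G - g x)))"
      by (rule Q.integrable_const_bound[where B = "exp (t * (2 * b))"])
        (use insert.prems(3) bnd[OF EGb] in \<open>auto intro!: AE_I2\<close>)
  qed (use insert in auto)
  also have "\<dots> \<le> (\<integral>x. exp (t * (integral\<^sup>L ?P G - G x)) * ?e \<partial>?P)"
  proof (rule integral_mono)
    show "integrable ?P (\<lambda>x. \<integral>y. exp (t * (integral\<^sup>L ?P G - g (x(j := y)))) \<partial>\<mu>)"
    proof (rule P.integrable_const_bound[where B = "exp (t * (2 * b))"])
      show "AE x in ?P. norm (\<integral>y. exp (t * (integral\<^sup>L ?P G - g (x(j := y)))) \<partial>\<mu>) \<le> exp (t * (2 * b))"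
        unfolding real_norm_def
        by (intro AE_I2 mu.abs_expectation_le) (use insert.prems(3) upd bnd[OF EGb] in auto)
      show "(\<lambda>x. \<integral>y. exp (t * (integral\<^sup>L ?P G - g (x(j := y)))) \<partial>\<mu>) \<in> borel_measurable ?P"
        using m2 by (intro mu.borel_measurable_lebesgue_integral) (simp add: case_prod_beta')
    qed
    have "integrable ?P (\<lambda>x. exp (t * (integral\<^sup>L ?P G - G x)))"
      by (rule P.integrable_const_bound[where B = "exp (t * (2 * b))"])
        (use Gb bnd[OF EGb] in \<open>auto intro!: AE_I2\<close>)
    then show "integrable ?P (\<lambda>x. exp (t * (integral\<^sup>L ?P G - G x)) * ?e)"
      by simp
  qed (use inner in auto)
  also have "\<dots> \<le> exp (real (card J) * (t\<^sup>2 * c\<^sup>2 / 2)) * ?e"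
    using GIH by simp
  also have "\<dots> = exp (real (card (insert j J)) * (t\<^sup>2 * c\<^sup>2 / 2))"
    using insert.hyps by (simp add: exp_add[symmetric] algebra_simps add_divide_distrib)
  finally show ?case .
qed

text \<open>
  McDiarmid's inequality for deviations all the way down from the mean \<open>m\<close> to \<open>0\<close>. Since only the
  symmetric bound \<open>c\<close> on the centred increments is used, the constant in the exponent is
  four times smaller than the optimal one.
\<close>

lemma bounded_differences_lower_tail:
  fixes \<mu> :: "'b measure" and g :: "('i \<Rightarrow> 'b) \<Rightarrow> real"
  assumes "prob_space \<mu>" and "finite I" "I \<noteq> {}"
    and g[measurable]: "g \<in> borel_measurable (PiM I (\<lambda>_. \<mu>))"
    and "\<And>x i y. x \<in> space (PiM I (\<lambda>_. \<mu>)) \<Longrightarrow> i \<in> I \<Longrightarrow> y \<in> space \<mu> \<Longrightarrow> \<bar>g x - g (x(i := y))\<bar> \<le> c"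
    and gb: "\<And>x. x \<in> space (PiM I (\<lambda>_. \<mu>)) \<Longrightarrow> \<bar>g x\<bar> \<le> b"
    and "c > 0" and m: "m = integral\<^sup>L (PiM I (\<lambda>_. \<mu>)) g" "m > 0"
  shows "measure (PiM I (\<lambda>_. \<mu>)) {x \<in> space (PiM I (\<lambda>_. \<mu>)). g x \<le> 0}
           \<le> exp (- m\<^sup>2 / (2 * real (card I) * c\<^sup>2))"
proof -
  let ?Q = "PiM I (\<lambda>_. \<mu>)"
  interpret Q: prob_space ?Q by (intro prob_space_PiM \<open>prob_space \<mu>\<close>)
  define N where "N = real (card I)"
  have N: "N > 0" using assms by (simp add: N_def card_gt_0_iff)
  \<comment> \<open>The minimiser of the exponent \<open>N * (t\<^sup>2 * c\<^sup>2 / 2) - t * m\<close> of the Markov bound below.\<close>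
  define t where "t = m / (N * c\<^sup>2)"
  have t: "t > 0" using N \<open>c > 0\<close> \<open>m > 0\<close> by (simp add: t_def)
  have mb: "\<bar>m\<bar> \<le> b"
    unfolding m by (rule Q.abs_expectation_le) (use gb in auto)
  have int: "integrable ?Q (\<lambda>x. exp (t * (m - g x)))"
  proof (rule Q.integrable_const_bound[where B = "exp (t * (2 * b))"])
    show "AE x in ?Q. norm (exp (t * (m - g x))) \<le> exp (t * (2 * b))"
      using gb mb t by (auto intro!: AE_I2) (smt (verit) abs_le_iff)
  qed simp
  have "Q.prob {x \<in> space ?Q. g x \<le> 0} \<le> Q.prob {x \<in> space ?Q. exp (t * m) \<le> exp (t * (m - g x))}"
    by (rule Q.finite_measure_mono) (use t in \<open>auto simp: algebra_simps mult_le_0_iff\<close>)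
  also have "\<dots> \<le> (\<integral>x. exp (t * (m - g x)) \<partial>?Q) / exp (t * m)"
    by (rule integral_Markov_inequality_measure[OF int, where A = "{}"]) auto
  also have "\<dots> \<le> exp (N * (t\<^sup>2 * c\<^sup>2 / 2)) / exp (t * m)"
    using mgf_bounded_differences[of \<mu> I g c b t] assms t
    by (intro divide_right_mono) (auto simp: N_def)
  also have "\<dots> = exp (N * (t\<^sup>2 * c\<^sup>2 / 2) - t * m)"
    by (simp add: exp_diff)
  also have "N * (t\<^sup>2 * c\<^sup>2 / 2) - t * m = - m\<^sup>2 / (2 * N * c\<^sup>2)"
    using N \<open>c > 0\<close> by (simp add: t_def field_simps power2_eq_square)
  finally show ?thesis by (simp add: N_def)
qed

section \<open>Rare events in one cell and in many disjoint cells\<close>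

text \<open>
  Conditionally on avoiding \<open>Q\<close> the sample is still independent, with the law \<open>\<mu>\<close> conditioned on
  the complement of \<open>Q\<close>, under which \<open>X\<close> has mean \<open>m\<close>; so the bound is Chebyshev's inequality for
  the conditional law. To avoid conditional measures the indicator \<open>S\<close> of avoidance is kept as a
  factor: it is a product over the coordinates, and the centred variable \<open>V\<close> vanishes on \<open>Q\<close>, so
  the mixed terms of the expectation of \<open>S * (\<Sum>V)\<^sup>2\<close> factorise and vanish.
\<close>

lemma avoiding_concentration:
  fixes \<mu> :: "'b measure" and I :: "'i set" and X :: "'b \<Rightarrow> real"
  assumes "prob_space \<mu>" and "finite I" "I \<noteq> {}"
    and X[measurable]: "X \<in> borel_measurable \<mu>" and XB: "\<And>x. x \<in> space \<mu> \<Longrightarrow> \<bar>X x\<bar> \<le> B"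
    and Q[measurable]: "Q \<in> sets \<mu>" and XQ: "\<And>x. x \<in> Q \<Longrightarrow> X x = 0"
    and p: "p = measure \<mu> Q" "p < 1" and m: "m = integral\<^sup>L \<mu> X / (1 - p)" and "r > 0"
  shows "(1 - p) ^ card I * (1 - real (card I) * (\<integral>x. (X x)\<^sup>2 \<partial>\<mu>) / ((1 - p) * r\<^sup>2))
    \<le> measure (PiM I (\<lambda>_. \<mu>)) {x \<in> space (PiM I (\<lambda>_. \<mu>)).
          (\<forall>i\<in>I. x i \<notin> Q) \<and> \<bar>(\<Sum>i\<in>I. X (x i)) - real (card I) * m\<bar> \<le> r}" (is "?L \<le> measure ?P ?F")
proof -
  interpret mu: prob_space \<mu> by fact
  interpret P: prob_space ?P by (intro prob_space_PiM \<open>prob_space \<mu>\<close>)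
  interpret prod: product_prob_space "\<lambda>_::'i. \<mu>" UNIV
    by unfold_locales
  define n where "n = card I"
  have n: "n > 0" using assms by (simp add: n_def card_gt_0_iff)
  define Y :: "'b \<Rightarrow> real" where "Y = indicator (space \<mu> - Q)"
  define V where "V = (\<lambda>x. X x - m * Y x)"
  have [measurable]: "Y \<in> borel_measurable \<mu>" "V \<in> borel_measurable \<mu>"
    by (auto simp: Y_def V_def)
  have Y01: "\<bar>Y x\<bar> \<le> 1" for x by (simp add: Y_def indicator_def)
  have VB: "\<bar>V x\<bar> \<le> B + \<bar>m\<bar>" if "x \<in> space \<mu>" for x
    using XB[OF that] mult_left_mono[OF Y01[of x], of "\<bar>m\<bar>"] unfolding V_def
    by (simp add: abs_mult[symmetric])
  have YV: "Y x * V x = V x" "Y x * Y x = Y x" "Y x * X x = X x" if "x \<in> space \<mu>" for x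
    using that XQ by (auto simp: V_def Y_def indicator_def)
  have intX: "integrable \<mu> X"
    by (rule mu.integrable_const_bound[where B = B]) (use XB in \<open>auto intro!: AE_I2\<close>)
  have "(X x)\<^sup>2 \<le> B\<^sup>2" if "x \<in> space \<mu>" for x
    using power_mono[OF XB[OF that], of 2] by simp
  then have intX2: "integrable \<mu> (\<lambda>x. (X x)\<^sup>2)"
    by (intro mu.integrable_const_bound[where B = "B\<^sup>2"]) (auto intro!: AE_I2)
  have intY: "integrable \<mu> Y"
    by (rule mu.integrable_const_bound[where B = 1]) (use Y01 in \<open>auto intro!: AE_I2\<close>)
  have intV: "integrable \<mu> V"
    unfolding V_def using intX intY by simp
  have EY: "integral\<^sup>L \<mu> Y = 1 - p"
    unfolding Y_def p using mu.prob_compl[OF Q] by simp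
  have EV: "integral\<^sup>L \<mu> V = 0"
    unfolding V_def using intX intY EY p(2) by (simp add: m)
  have VV: "V x * V x = (X x)\<^sup>2 - 2 * m * X x + m\<^sup>2 * Y x" if "x \<in> space \<mu>" for x
  proof (cases "x \<in> Q")
    case True
    then show ?thesis using XQ[OF True] by (simp add: V_def Y_def)
  next
    case False
    then have "Y x = 1" using that by (simp add: Y_def)
    then show ?thesis by (simp add: V_def algebra_simps power2_eq_square)
  qed
  have EVV: "(\<integral>x. V x * V x \<partial>\<mu>) \<le> (\<integral>x. (X x)\<^sup>2 \<partial>\<mu>)"
  proof -
    have "(\<integral>x. V x * V x \<partial>\<mu>) = (\<integral>x. (X x)\<^sup>2 - 2 * m * X x + m\<^sup>2 * Y x \<partial>\<mu>)"
      by (rule Bochner_Integration.integral_cong) (use VV in auto)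
    also have "\<dots> = (\<integral>x. (X x)\<^sup>2 \<partial>\<mu>) - 2 * m * integral\<^sup>L \<mu> X + m\<^sup>2 * (1 - p)"
      using intX intX2 intY by (simp add: EY)
    also have "integral\<^sup>L \<mu> X = m * (1 - p)" using p(2) by (simp add: m)
    finally have "(\<integral>x. V x * V x \<partial>\<mu>) = (\<integral>x. (X x)\<^sup>2 \<partial>\<mu>) - m\<^sup>2 * (1 - p)"
      by (simp add: power2_eq_square algebra_simps)
    then show ?thesis using p(2) by simp
  qed
  define S where "S = (\<lambda>x. \<Prod>i\<in>I. Y (x i))"
  define T where "T = (\<lambda>x. (\<Sum>i\<in>I. V (x i)))"
  \<comment> \<open>The \<open>l\<close>-th factor of \<open>S * V (x i) * V (x k)\<close> as a product over all coordinates.\<close>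
  define \<phi> where "\<phi> = (\<lambda>(i::'i) k l x. Y x * (if l = i then V x else 1) * (if l = k then V x else 1))"
  have phi_m[measurable]: "\<phi> i k l \<in> borel_measurable \<mu>" for i k l
    unfolding \<phi>_def by measurable
  have phi_int: "integrable \<mu> (\<phi> i k l)" for i k l
  proof (rule mu.integrable_const_bound[where B = "1 * (1 + (B + \<bar>m\<bar>)) * (1 + (B + \<bar>m\<bar>))"])
    show "AE x in \<mu>. norm (\<phi> i k l x) \<le> 1 * (1 + (B + \<bar>m\<bar>)) * (1 + (B + \<bar>m\<bar>))"
    proof (rule AE_I2)
      fix x assume "x \<in> space \<mu>"
      from VB[OF this] show "norm (\<phi> i k l x) \<le> 1 * (1 + (B + \<bar>m\<bar>)) * (1 + (B + \<bar>m\<bar>))"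
        unfolding \<phi>_def real_norm_def abs_mult
        by (intro mult_mono) (use Y01 in auto)
    qed
  qed simp
  have expand: "S x * (T x)\<^sup>2 = (\<Sum>i\<in>I. \<Sum>k\<in>I. \<Prod>l\<in>I. \<phi> i k l (x l))" for x
  proof -
    have "(\<Prod>l\<in>I. \<phi> i k l (x l)) = S x * (V (x i) * V (x k))" if "i \<in> I" "k \<in> I" for i k
      unfolding \<phi>_def S_def using \<open>finite I\<close> that by (simp add: prod.distrib)
    then have "(\<Sum>i\<in>I. \<Sum>k\<in>I. \<Prod>l\<in>I. \<phi> i k l (x l)) = (\<Sum>i\<in>I. \<Sum>k\<in>I. S x * (V (x i) * V (x k)))"
      by simp
    also have "\<dots> = S x * (T x)\<^sup>2"
      unfolding T_def power2_eq_square sum_product by (simp only: sum_distrib_left)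
    finally show ?thesis by simp
  qed
  have E_phi: "(\<integral>x. (\<Prod>l\<in>I. \<phi> i k l (x l)) \<partial>?P)
     = (if i = k then (1 - p) ^ (n - 1) * (\<integral>x. V x * V x \<partial>\<mu>) else 0)" if ik: "i \<in> I" "k \<in> I" for i k
  proof -
    have "(\<integral>x. (\<Prod>l\<in>I. \<phi> i k l (x l)) \<partial>?P) = (\<Prod>l\<in>I. integral\<^sup>L \<mu> (\<phi> i k l))"
      by (rule prod.product_integral_prod) (use phi_int \<open>finite I\<close> in auto)
    also have "\<dots> = integral\<^sup>L \<mu> (\<phi> i k i) * (\<Prod>l\<in>I - {i}. integral\<^sup>L \<mu> (\<phi> i k l))"
      by (rule prod.remove) (use \<open>finite I\<close> ik in auto)
    also have "\<dots> = (if i = k then (1 - p) ^ (n - 1) * (\<integral>x. V x * V x \<partial>\<mu>) else 0)"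
    proof (cases "i = k")
      case True
      have "(\<Prod>l\<in>I - {i}. integral\<^sup>L \<mu> (\<phi> i k l)) = (\<Prod>l\<in>I - {i}. 1 - p)"
        by (rule prod.cong) (auto simp: \<phi>_def EY True)
      moreover have "integral\<^sup>L \<mu> (\<phi> i k i) = (\<integral>x. V x * V x \<partial>\<mu>)"
        by (rule Bochner_Integration.integral_cong) (use True YV in \<open>auto simp: \<phi>_def\<close>)
      ultimately show ?thesis using True ik \<open>finite I\<close> by (simp add: n_def)
    next
      case False
      have "integral\<^sup>L \<mu> (\<phi> i k i) = integral\<^sup>L \<mu> V"
        by (rule Bochner_Integration.integral_cong) (use False YV in \<open>auto simp: \<phi>_def\<close>)
      then show ?thesis using False EV by simp
    qed
    finally show ?thesis .
  qed
  have int_prod: "integrable ?P (\<lambda>x. \<Prod>l\<in>I. \<phi> i k l (x l))" for i k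
    by (rule prod.product_integrable_prod) (use phi_int \<open>finite I\<close> in auto)
  have intST: "integrable ?P (\<lambda>x. S x * (T x)\<^sup>2)"
    unfolding expand using int_prod by simp
  have "(\<integral>x. S x * (T x)\<^sup>2 \<partial>?P) = (\<Sum>i\<in>I. \<Sum>k\<in>I. if i = k then (1 - p) ^ (n - 1) * (\<integral>x. V x * V x \<partial>\<mu>) else 0)"
    unfolding expand using int_prod E_phi by simp
  also have "\<dots> = real n * ((1 - p) ^ (n - 1) * (\<integral>x. V x * V x \<partial>\<mu>))"
    using \<open>finite I\<close> by (simp add: n_def)
  also have "\<dots> \<le> real n * ((1 - p) ^ (n - 1) * (\<integral>x. (X x)\<^sup>2 \<partial>\<mu>))"
    using EVV p(2) by (intro mult_left_mono) auto
  finally have EST: "(\<integral>x. S x * (T x)\<^sup>2 \<partial>?P) \<le> real n * ((1 - p) ^ (n - 1) * (\<integral>x. (X x)\<^sup>2 \<partial>\<mu>))" .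
  have intS: "integrable ?P S"
    unfolding S_def by (rule prod.product_integrable_prod) (use intY \<open>finite I\<close> in auto)
  have ES: "integral\<^sup>L ?P S = (1 - p) ^ n"
  proof -
    have "integral\<^sup>L ?P S = (\<Prod>i\<in>I. integral\<^sup>L \<mu> Y)"
      unfolding S_def by (rule prod.product_integral_prod) (use intY \<open>finite I\<close> in auto)
    then show ?thesis by (simp add: EY n_def)
  qed
  have F_m[measurable]: "?F \<in> sets ?P"
    using \<open>finite I\<close> by measurable
  have "?L = (1 - p) ^ n - real n * ((1 - p) ^ (n - 1) * (\<integral>x. (X x)\<^sup>2 \<partial>\<mu>)) / r\<^sup>2"
    using p(2) \<open>r > 0\<close> n unfolding n_def[symmetric]
    by (simp add: power_eq_if[of "1 - p" n] field_simps)
  also have "\<dots> \<le> integral\<^sup>L ?P S - (\<integral>x. S x * (T x)\<^sup>2 \<partial>?P) / r\<^sup>2"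
    unfolding ES using EST by (simp add: divide_right_mono)
  also have "\<dots> = (\<integral>x. S x - S x * (T x)\<^sup>2 / r\<^sup>2 \<partial>?P)"
    using intS intST by simp
  also have "\<dots> \<le> (\<integral>x. indicator ?F x \<partial>?P)"
  proof (rule integral_mono)
    fix x assume x: "x \<in> space ?P"
    then have xs: "x i \<in> space \<mu>" if "i \<in> I" for i
      using that by (auto simp: space_PiM)
    show "S x - S x * (T x)\<^sup>2 / r\<^sup>2 \<le> indicator ?F x"
    proof (cases "\<forall>i\<in>I. x i \<notin> Q")
      case True
      then have "S x = 1"
        unfolding S_def using xs by (intro prod.neutral) (auto simp: Y_def)
      moreover have "T x = (\<Sum>i\<in>I. X (x i)) - real n * m"
      proof -
        have "T x = (\<Sum>i\<in>I. X (x i) - m)"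
          unfolding T_def V_def using True xs by (intro sum.cong) (auto simp: Y_def)
        then show ?thesis by (simp add: sum_subtractf n_def)
      qed
      ultimately show ?thesis
        using True x \<open>r > 0\<close> abs_le_square_iff[of r "T x"]
        by (auto simp: indicator_def n_def field_simps)
    next
      case False
      then obtain i where "i \<in> I" "x i \<in> Q" by auto
      then have "S x = 0"
        unfolding S_def using \<open>finite I\<close> by (intro prod_zero bexI[of _ i]) (auto simp: Y_def)
      then show ?thesis by simp
    qed
  qed (use intS intST F_m P.emeasure_finite in \<open>auto simp: less_top[symmetric]\<close>)
  also have "\<dots> = measure ?P ?F"
    by simp
  finally show ?thesis .
qed

text \<open>
  The events of different cells are dependent, because the cells compete for the same observations.
  But one observation meets the support of at most one \<open>\<phi> j\<close>, so that moving it changes the number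
  of events that occur by at most \<open>2\<close>, and bounded differences replace independence.
  The bound is useful as soon as the expected number \<open>q * card J\<close> is far above \<open>sqrt (card I)\<close>.
\<close>

lemma prob_no_cell_event_le:
  fixes \<mu> :: "'b measure" and \<phi> :: "'j \<Rightarrow> 'b \<Rightarrow> real" and D :: "'j \<Rightarrow> real set"
  assumes "prob_space \<mu>" and "finite I" "I \<noteq> {}" and "finite J" "J \<noteq> {}"
    and \<phi>[measurable]: "\<And>j. \<phi> j \<in> borel_measurable \<mu>" and D[measurable]: "\<And>j. D j \<in> sets borel"
    and disj: "\<And>x j k. j \<in> J \<Longrightarrow> k \<in> J \<Longrightarrow> \<phi> j x \<noteq> 0 \<Longrightarrow> \<phi> k x \<noteq> 0 \<Longrightarrow> j = k"
    and "q > 0"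
    and q: "\<And>j. j \<in> J \<Longrightarrow>
      q \<le> measure (PiM I (\<lambda>_. \<mu>)) {x \<in> space (PiM I (\<lambda>_. \<mu>)). (\<Sum>i\<in>I. \<phi> j (x i)) \<in> D j}"
  shows "measure (PiM I (\<lambda>_. \<mu>)) {x \<in> space (PiM I (\<lambda>_. \<mu>)). \<forall>j\<in>J. (\<Sum>i\<in>I. \<phi> j (x i)) \<notin> D j}
    \<le> exp (- (q * real (card J))\<^sup>2 / (8 * real (card I)))"
proof -
  let ?P = "PiM I (\<lambda>_. \<mu>)"
  interpret P: prob_space ?P by (intro prob_space_PiM \<open>prob_space \<mu>\<close>)
  define d where "d = (\<lambda>j x. indicator (D j) (\<Sum>i\<in>I. \<phi> j (x i)) :: real)"
  define g where "g = (\<lambda>x. \<Sum>j\<in>J. d j x)"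
  have d_m[measurable]: "d j \<in> borel_measurable ?P" for j
    unfolding d_def using \<open>finite I\<close> by measurable
  have [measurable]: "g \<in> borel_measurable ?P"
    unfolding g_def by measurable
  have d01: "0 \<le> d j x" "d j x \<le> 1" for j x
    by (auto simp: d_def)
  have touch: "(\<Sum>j\<in>J. of_bool (\<phi> j a \<noteq> 0)) \<le> (1::real)" for a
  proof -
    have "(\<Sum>j\<in>J. of_bool (\<phi> j a \<noteq> 0)) = real (card {j \<in> J. \<phi> j a \<noteq> 0})"
      using \<open>finite J\<close> by (simp add: sum.If_cases of_bool_def Int_def)
    also have "card {j \<in> J. \<phi> j a \<noteq> 0} \<le> Suc 0"
      using \<open>finite J\<close> disj by (subst card_le_Suc0_iff_eq) auto
    finally show ?thesis by simp
  qed
  have diff: "\<bar>g x - g (x(i := y))\<bar> \<le> 2" if i: "i \<in> I" for x i y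
  proof -
    have "\<bar>g x - g (x(i := y))\<bar> \<le> (\<Sum>j\<in>J. \<bar>d j x - d j (x(i := y))\<bar>)"
      unfolding g_def sum_subtractf[symmetric] by (rule sum_abs)
    also have "\<dots> \<le> (\<Sum>j\<in>J. of_bool (\<phi> j (x i) \<noteq> 0) + of_bool (\<phi> j y \<noteq> 0))"
    proof (rule sum_mono)
      fix j
      show "\<bar>d j x - d j (x(i := y))\<bar> \<le> of_bool (\<phi> j (x i) \<noteq> 0) + of_bool (\<phi> j y \<noteq> 0)"
      proof (cases "\<phi> j (x i) = 0 \<and> \<phi> j y = 0")
        case True
        then have "\<phi> j ((x(i := y)) l) = \<phi> j (x l)" for l by simp
        then have "d j (x(i := y)) = d j x" unfolding d_def by presburger
        then show ?thesis by simp
      next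
        case False
        then show ?thesis using d01[of j x] d01[of j "x(i := y)"] by auto
      qed
    qed
    also have "\<dots> \<le> 2"
      using touch[of "x i"] touch[of y] by (simp add: sum.distrib)
    finally show ?thesis .
  qed
  have gb: "\<bar>g x\<bar> \<le> real (card J)" for x
    unfolding g_def using d01 sum_mono[of J "\<lambda>j. d j x" "\<lambda>_. 1"] by (simp add: sum_nonneg)
  have Ed: "integral\<^sup>L ?P (d j) = P.prob {x \<in> space ?P. (\<Sum>i\<in>I. \<phi> j (x i)) \<in> D j}" for j
  proof -
    have "integral\<^sup>L ?P (d j) = (\<integral>x. indicator {x \<in> space ?P. (\<Sum>i\<in>I. \<phi> j (x i)) \<in> D j} x \<partial>?P)"
      by (rule Bochner_Integration.integral_cong) (auto simp: d_def indicator_def)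
    then show ?thesis by simp
  qed
  have dint: "integrable ?P (d j)" for j
    by (rule P.integrable_const_bound[where B = 1]) (use d01 in \<open>auto intro!: AE_I2\<close>)
  have Eg: "q * real (card J) \<le> integral\<^sup>L ?P g"
  proof -
    have "(\<Sum>j\<in>J. q) \<le> (\<Sum>j\<in>J. integral\<^sup>L ?P (d j))"
      by (rule sum_mono) (use q Ed in auto)
    then show ?thesis unfolding g_def using dint by (simp add: mult.commute)
  qed
  have qJ: "q * real (card J) > 0" using assms by (simp add: card_gt_0_iff)
  have cI: "real (card I) > 0" using assms by (simp add: card_gt_0_iff)
  have "{x \<in> space ?P. \<forall>j\<in>J. (\<Sum>i\<in>I. \<phi> j (x i)) \<notin> D j} \<subseteq> {x \<in> space ?P. g x \<le> 0}"
    unfolding g_def by (auto simp: d_def)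
  then have "P.prob {x \<in> space ?P. \<forall>j\<in>J. (\<Sum>i\<in>I. \<phi> j (x i)) \<notin> D j} \<le> P.prob {x \<in> space ?P. g x \<le> 0}"
    by (rule P.finite_measure_mono) measurable
  also have "\<dots> \<le> exp (- (integral\<^sup>L ?P g)\<^sup>2 / (2 * real (card I) * 2\<^sup>2))"
    by (rule bounded_differences_lower_tail[where b = "real (card J)"])
      (use assms diff gb Eg qJ in auto)
  also have "\<dots> \<le> exp (- (q * real (card J))\<^sup>2 / (8 * real (card I)))"
    using Eg qJ cI by (auto intro!: divide_right_mono power_mono)
  finally show ?thesis .
qed

section \<open>Kernels with compact support and bounded variation\<close>

text \<open>
  For a box with lower corner \<open>x\<close> whose upper corner exceeds the support in every coordinate, all
  vertices other than \<open>x\<close> lie off the support. The increment over this box is \<open>K x\<close> up to sign.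
\<close>

lemma bounded_variation_imp_bounded:
  fixes K :: "real ^ 'd \<Rightarrow> real"
  assumes "bounded_variation K" and "compact_support K"
  obtains B where "\<And>x. \<bar>K x\<bar> \<le> B"
proof -
  obtain B where B: "\<And>a b D. D division_of cbox a b \<Longrightarrow>
      (\<Sum>C\<in>D. \<bar>box_increment K (interval_lowerbound C) (interval_upperbound C)\<bar>) \<le> B"
    using assms(1) unfolding bounded_variation_def by blast
  have "bounded (closure {x. K x \<noteq> 0})"
    using assms(2) unfolding compact_support_def by (rule compact_imp_bounded)
  then obtain R where R: "\<And>x. x \<in> closure {x. K x \<noteq> 0} \<Longrightarrow> norm x \<le> R"
    unfolding bounded_iff by blast
  have R: "K x = 0" if "norm x > R" for x
    using R[of x] that closure_subset[of "{x. K x \<noteq> 0}"] by fastforce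
  have "\<bar>K x\<bar> \<le> B" for x
  proof -
    define b :: "real ^ 'd" where "b = (\<chi> i. max (x $ i) (R + 1))"
    have ne: "cbox x b \<noteq> {}" by (auto simp: interval_ne_empty_cart b_def)
    let ?v = "\<lambda>S. (\<chi> i. if i \<in> S then x $ i else b $ i)"
    have zero: "K (?v S) = 0" if "S \<noteq> UNIV" for S
    proof -
      obtain i where "i \<notin> S" using \<open>S \<noteq> UNIV\<close> by blast
      then have "R < \<bar>?v S $ i\<bar>" by (auto simp: b_def)
      also have "\<dots> \<le> norm (?v S)" by (rule component_le_norm_cart)
      finally show ?thesis by (rule R)
    qed
    have "box_increment K x b = (\<Sum>S\<in>(UNIV::'d set set). if S = UNIV then (- 1) ^ CARD('d) * K x else 0)"
      unfolding box_increment_def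
    proof (rule sum.cong[OF refl])
      fix S :: "'d set"
      show "(- 1) ^ card S * K (?v S) = (if S = UNIV then (- 1) ^ CARD('d) * K x else 0)"
        by (cases "S = UNIV") (use zero[of S] in auto)
    qed
    also have "\<dots> = (- 1) ^ CARD('d) * K x" by simp
    finally have "\<bar>box_increment K x b\<bar> = \<bar>K x\<bar>" by (simp add: abs_mult power_abs)
    moreover have "\<bar>box_increment K x b\<bar> \<le> B"
      using B[OF division_of_self[OF ne]] ne by simp
    ultimately show ?thesis by simp
  qed
  then show ?thesis by (rule that)
qed

text \<open>
  If \<open>K\<close> integrated to \<open>0\<close> over all sets of measure at most \<open>v\<close>, then it would do so over finite
  unions of small balls intersected with \<open>cball 0 R\<close>, made disjoint one at a time, and hence over
  its whole support.
\<close>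

lemma small_set_carrying_mass:
  fixes K :: "'a::euclidean_space \<Rightarrow> real"
  assumes K: "integrable lborel K" "integral\<^sup>L lborel K \<noteq> 0"
    and R: "\<And>x. K x \<noteq> 0 \<Longrightarrow> norm x \<le> R" and "v > 0"
  obtains A where "A \<in> sets borel" "A \<subseteq> cball 0 R" "measure lborel A \<le> v"
    "(\<integral>x. indicator A x * K x \<partial>lborel) \<noteq> 0"
proof (rule ccontr)
  assume "\<not> thesis"
  with that have *: "(\<integral>x. indicator A x * K x \<partial>lborel) = 0"
    if "A \<in> sets borel" "A \<subseteq> cball 0 R" "measure lborel A \<le> v" for A
    using that by blast
  have int: "integrable lborel (\<lambda>x. indicator A x * K x)" if "A \<in> sets borel" for A
    using integrable_mult_indicator[OF _ K(1), of A] that by simp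
  have "((\<lambda>r. unit_ball_vol (real DIM('a)) * r ^ DIM('a)) \<longlongrightarrow> unit_ball_vol (real DIM('a)) * 0 ^ DIM('a)) (at_right 0)"
    by (intro tendsto_intros)
  then have "\<forall>\<^sub>F r in at_right 0. unit_ball_vol (real DIM('a)) * r ^ DIM('a) < v"
    by (rule order_tendstoD) (use \<open>v > 0\<close> in \<open>simp add: power_0_left\<close>)
  moreover have "\<forall>\<^sub>F r in at_right (0::real). 0 < r"
    by (simp add: eventually_at_right_less)
  ultimately obtain r :: real where r: "r > 0" "unit_ball_vol (real DIM('a)) * r ^ DIM('a) < v"
    using eventually_happens'[OF trivial_limit_at_right_real eventually_conj] by blast
  have small: "measure lborel (cball 0 R \<inter> ball c r - A) \<le> v" if "A \<in> sets borel" for c :: 'a and A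
  proof -
    have "measure lborel (cball 0 R \<inter> ball c r - A) \<le> measure lborel (ball c r)"
    proof (rule measure_mono_fmeasurable)
      show "ball c r \<in> fmeasurable lborel"
        by (intro fmeasurableI emeasure_bounded_finite) auto
    qed (use that in auto)
    then show ?thesis using r content_ball[of r c] by simp
  qed
  obtain C where C: "finite C" "cball (0::'a) R \<subseteq> (\<Union>c\<in>C. ball c r)"
    using seq_compact_imp_totally_bounded[OF compact_imp_seq_compact[OF compact_cball[of "0::'a" R]],
        rule_format, OF r(1)] by auto
  have "(\<integral>x. indicator (cball 0 R \<inter> (\<Union>c\<in>C. ball c r)) x * K x \<partial>lborel) = 0"
    using C(1)
  proof induction
    case (insert c C)
    let ?U = "cball 0 R \<inter> (\<Union>c\<in>C. ball c r)" and ?N = "cball 0 R \<inter> ball c r - (\<Union>c\<in>C. ball c r)"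
    have [measurable]: "?U \<in> sets borel" "?N \<in> sets borel"
      by (intro sets.Int sets.Diff borel_open borel_closed; auto)+
    have "(\<integral>x. indicator (cball 0 R \<inter> (\<Union>c\<in>insert c C. ball c r)) x * K x \<partial>lborel)
        = (\<integral>x. indicator ?U x * K x + indicator ?N x * K x \<partial>lborel)"
      by (rule Bochner_Integration.integral_cong) (auto simp: indicator_def)
    also have "\<dots> = (\<integral>x. indicator ?U x * K x \<partial>lborel) + (\<integral>x. indicator ?N x * K x \<partial>lborel)"
      by (rule Bochner_Integration.integral_add) (intro int, simp)+
    also have "\<dots> = 0"
      using insert.IH *[of ?N] small[of "(\<Union>c\<in>C. ball c r)" c] by (auto intro: borel_open)
    finally show ?case .
  qed simp
  moreover have "(\<integral>x. indicator (cball 0 R \<inter> (\<Union>c\<in>C. ball c r)) x * K x \<partial>lborel) = integral\<^sup>L lborel K"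
  proof (rule Bochner_Integration.integral_cong)
    fix x
    have "x \<in> cball 0 R \<inter> (\<Union>c\<in>C. ball c r)" if "K x \<noteq> 0"
      using R[OF that] C(2) by (metis IntI mem_cball_0 subsetD)
    then show "indicator (cball 0 R \<inter> (\<Union>c\<in>C. ball c r)) x * K x = K x"
      by (cases "K x = 0") (simp_all del: Int_iff UN_iff)
  qed simp
  ultimately show False using K(2) by simp
qed

section \<open>Expectations at the scale of one cell\<close>

lemma integral_lborel_reflect_scale:
  fixes g :: "'a::euclidean_space \<Rightarrow> real"
  assumes [measurable]: "g \<in> borel_measurable borel" and "s > 0"
  shows "integral\<^sup>L lborel g = s ^ DIM('a) * (\<integral>u. g (z - s *\<^sub>R u) \<partial>lborel)"
proof -
  have "integral\<^sup>L lborel g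
      = integral\<^sup>L (density (distr lborel borel (\<lambda>u. z + (- s) *\<^sub>R u)) (\<lambda>_. ennreal (\<bar>- s\<bar> ^ DIM('a)))) g"
    by (subst lborel_affine[of "- s" z]) (use \<open>s > 0\<close> in auto)
  also have "\<dots> = (\<integral>x. (\<bar>- s\<bar> ^ DIM('a)) *\<^sub>R g x \<partial>distr lborel borel (\<lambda>u. z + (- s) *\<^sub>R u))"
    by (rule integral_density) auto
  also have "\<dots> = (\<integral>u. (\<bar>- s\<bar> ^ DIM('a)) *\<^sub>R g (z + (- s) *\<^sub>R u) \<partial>lborel)"
    by (rule integral_distr) auto
  finally show ?thesis using \<open>s > 0\<close> by simp
qed

lemma integral_local_density:
  fixes \<mu> :: "'a::euclidean_space measure" and f G :: "'a \<Rightarrow> real"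
  assumes \<mu>[measurable_cong]: "sets \<mu> = sets borel"
    and dens: "\<And>A. A \<in> sets borel \<Longrightarrow> A \<subseteq> U \<Longrightarrow> emeasure \<mu> A = (\<integral>\<^sup>+x\<in>A. ennreal (f x) \<partial>lborel)"
    and U: "open U" and f: "continuous_on U f" and pos: "\<And>x. x \<in> U \<Longrightarrow> f x > 0"
    and G[measurable]: "G \<in> borel_measurable borel" and GU: "\<And>x. G x \<noteq> 0 \<Longrightarrow> x \<in> U"
  shows "integral\<^sup>L \<mu> G = (\<integral>x. (indicator U x * f x) * G x \<partial>lborel)"
proof -
  have [measurable]: "U \<in> sets borel" using U by auto
  have fm[measurable]: "(\<lambda>x. indicator U x * f x) \<in> borel_measurable borel"
    using borel_measurable_continuous_on_indicator[OF _ f] by simp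
  have f0: "0 \<le> indicator U x * f x" for x
    using pos[of x] by (auto simp: indicator_def)
  have eq: "density \<mu> (\<lambda>x. ennreal (indicator U x)) = density lborel (\<lambda>x. ennreal (indicator U x * f x))"
  proof (rule measure_eqI)
    fix A assume "A \<in> sets (density \<mu> (\<lambda>x. ennreal (indicator U x)))"
    then have A[measurable]: "A \<in> sets borel" by (simp add: \<mu>)
    have "emeasure (density \<mu> (\<lambda>x. ennreal (indicator U x))) A
        = (\<integral>\<^sup>+x. ennreal (indicator U x) * indicator A x \<partial>\<mu>)"
      by (rule emeasure_density) auto
    also have "\<dots> = (\<integral>\<^sup>+x. indicator (A \<inter> U) x \<partial>\<mu>)"
      by (rule nn_integral_cong) (auto simp: indicator_def)
    also have "\<dots> = emeasure \<mu> (A \<inter> U)" by simp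
    also have "\<dots> = (\<integral>\<^sup>+x\<in>A \<inter> U. ennreal (f x) \<partial>lborel)"
      by (rule dens) auto
    also have "\<dots> = (\<integral>\<^sup>+x. ennreal (indicator U x * f x) * indicator A x \<partial>lborel)"
      by (rule nn_integral_cong) (auto simp: indicator_def)
    also have "\<dots> = emeasure (density lborel (\<lambda>x. ennreal (indicator U x * f x))) A"
      by (rule emeasure_density[symmetric]) auto
    finally show "emeasure (density \<mu> (\<lambda>x. ennreal (indicator U x))) A
      = emeasure (density lborel (\<lambda>x. ennreal (indicator U x * f x))) A" .
  qed (simp add: \<mu>)
  have "integral\<^sup>L \<mu> G = (\<integral>x. indicator U x *\<^sub>R G x \<partial>\<mu>)"
    by (rule Bochner_Integration.integral_cong) (use GU in \<open>auto simp: indicator_def\<close>)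
  also have "\<dots> = integral\<^sup>L (density \<mu> (\<lambda>x. ennreal (indicator U x))) G"
    by (rule integral_density[symmetric]) auto
  also have "\<dots> = (\<integral>x. (indicator U x * f x) *\<^sub>R G x \<partial>lborel)"
    unfolding eq by (rule integral_density) (use f0 in auto)
  finally show ?thesis by simp
qed

text \<open>
  The substitution \<open>x = z - s *\<^sub>R u\<close> turns the expectation into an integral of \<open>G\<close> against values of
  the density near \<open>z\<close>, which are all within \<open>\<tau>\<close> of \<open>f0\<close>.
\<close>

lemma local_expectation:
  fixes \<mu> :: "'a::euclidean_space measure" and f G :: "'a \<Rightarrow> real"
  assumes \<mu>[measurable_cong]: "sets \<mu> = sets borel"
    and dens: "\<And>A. A \<in> sets borel \<Longrightarrow> A \<subseteq> U \<Longrightarrow> emeasure \<mu> A = (\<integral>\<^sup>+x\<in>A. ennreal (f x) \<partial>lborel)"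
    and U: "open U" and f: "continuous_on U f" and pos: "\<And>x. x \<in> U \<Longrightarrow> f x > 0"
    and G: "integrable lborel G" and GR: "\<And>u. G u \<noteq> 0 \<Longrightarrow> norm u \<le> R"
    and "s > 0"
    and near: "\<And>u. norm u \<le> R \<Longrightarrow> z - s *\<^sub>R u \<in> U \<and> \<bar>f (z - s *\<^sub>R u) - f0\<bar> \<le> \<tau>"
  shows "\<bar>(\<integral>x. G ((z - x) /\<^sub>R s) \<partial>\<mu>) - s ^ DIM('a) * (f0 * integral\<^sup>L lborel G)\<bar>
    \<le> s ^ DIM('a) * (\<tau> * (\<integral>u. \<bar>G u\<bar> \<partial>lborel))"
proof -
  have Gm[measurable]: "G \<in> borel_measurable borel"
    using G by (simp add: borel_measurable_integrable)
  have [measurable]: "U \<in> sets borel" using U by auto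
  let ?f = "\<lambda>x. indicator U x * f x"
  have fm[measurable]: "?f \<in> borel_measurable borel"
    using borel_measurable_continuous_on_indicator[OF _ f] by simp
  have "(\<integral>x. G ((z - x) /\<^sub>R s) \<partial>\<mu>) = (\<integral>x. ?f x * G ((z - x) /\<^sub>R s) \<partial>lborel)"
  proof (rule integral_local_density[where U = U and f = f])
    show "(\<lambda>x. G ((z - x) /\<^sub>R s)) \<in> borel_measurable borel"
      by measurable
    fix x assume "G ((z - x) /\<^sub>R s) \<noteq> 0"
    from near[OF GR[OF this]] show "x \<in> U" using \<open>s > 0\<close> by simp
  qed (use \<mu> dens U f pos in auto)
  also have "\<dots> = s ^ DIM('a) * (\<integral>u. ?f (z - s *\<^sub>R u) * G u \<partial>lborel)"
    using integral_lborel_reflect_scale[of "\<lambda>x. ?f x * G ((z - x) /\<^sub>R s)" s z] \<open>s > 0\<close> by simp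
  finally have E: "(\<integral>x. G ((z - x) /\<^sub>R s) \<partial>\<mu>) = s ^ DIM('a) * (\<integral>u. ?f (z - s *\<^sub>R u) * G u \<partial>lborel)" .
  have bd: "\<bar>(?f (z - s *\<^sub>R u) - f0) * G u\<bar> \<le> \<tau> * \<bar>G u\<bar>" for u
    using near[of u] GR[of u] by (cases "G u = 0") (auto simp: abs_mult intro!: mult_right_mono)
  have int: "integrable lborel (\<lambda>u. (?f (z - s *\<^sub>R u) - f0) * G u)"
  proof (rule Bochner_Integration.integrable_bound)
    show "integrable lborel (\<lambda>u. \<tau> * \<bar>G u\<bar>)" using G by simp
    show "AE u in lborel. norm ((?f (z - s *\<^sub>R u) - f0) * G u) \<le> norm (\<tau> * \<bar>G u\<bar>)"
      using bd by (intro AE_I2) (smt (verit) real_norm_def)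
  qed measurable
  have "(\<integral>u. ?f (z - s *\<^sub>R u) * G u \<partial>lborel)
      = (\<integral>u. (?f (z - s *\<^sub>R u) - f0) * G u + f0 * G u \<partial>lborel)"
    by (simp add: algebra_simps)
  also have "\<dots> = (\<integral>u. (?f (z - s *\<^sub>R u) - f0) * G u \<partial>lborel) + f0 * integral\<^sup>L lborel G"
    using int G by (subst Bochner_Integration.integral_add) auto
  finally have "(\<integral>x. G ((z - x) /\<^sub>R s) \<partial>\<mu>) - s ^ DIM('a) * (f0 * integral\<^sup>L lborel G)
      = s ^ DIM('a) * (\<integral>u. (?f (z - s *\<^sub>R u) - f0) * G u \<partial>lborel)"
    unfolding E by (simp add: algebra_simps)
  moreover have "\<bar>\<integral>u. (?f (z - s *\<^sub>R u) - f0) * G u \<partial>lborel\<bar> \<le> \<tau> * (\<integral>u. \<bar>G u\<bar> \<partial>lborel)"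
  proof -
    have "\<bar>\<integral>u. (?f (z - s *\<^sub>R u) - f0) * G u \<partial>lborel\<bar> \<le> (\<integral>u. \<bar>(?f (z - s *\<^sub>R u) - f0) * G u\<bar> \<partial>lborel)"
      by (rule integral_abs_bound)
    also have "\<dots> \<le> (\<integral>u. \<tau> * \<bar>G u\<bar> \<partial>lborel)"
      by (rule integral_mono) (use int G bd in auto)
    finally show ?thesis by simp
  qed
  ultimately show ?thesis using \<open>s > 0\<close> by (simp add: abs_mult)
qed

section \<open>Separated cell centres\<close>

lemma separated_points:
  fixes z0 :: "real ^ 'd"
  assumes "a > 0" and a: "real CARD('d) * a \<le> \<rho>"
  obtains J where "finite J" "J \<subseteq> cball z0 \<rho>" "\<And>y z. y \<in> J \<Longrightarrow> z \<in> J \<Longrightarrow> y \<noteq> z \<Longrightarrow> a \<le> dist y z"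
    "(\<rho> / (2 * real CARD('d) * a)) ^ CARD('d) \<le> real (card J)"
proof -
  define x where "x = \<rho> / (real CARD('d) * a)"
  have x: "x \<ge> 1" unfolding x_def using assms by simp
  define m where "m = nat \<lfloor>x\<rfloor>"
  have m: "real m \<le> x" "x / 2 \<le> real m"
  proof -
    have "real m = real_of_int \<lfloor>x\<rfloor>" "\<lfloor>x\<rfloor> \<ge> 1" using x by (auto simp: m_def le_floor_iff)
    then show "real m \<le> x" "x / 2 \<le> real m" by linarith+
  qed
  define P where "P = (UNIV::'d set) \<rightarrow>\<^sub>E {..<m}"
  define p where "p = (\<lambda>k. z0 + (\<chi> i. a * real (k i)) :: real ^ 'd)"
  have sep: "a \<le> dist (p k) (p l)" if "k \<noteq> l" for k l
  proof -
    obtain i where "k i \<noteq> l i" using \<open>k \<noteq> l\<close> by blast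
    then have "1 \<le> \<bar>real (k i) - real (l i)\<bar>" by linarith
    then have "a \<le> a * \<bar>real (k i) - real (l i)\<bar>" using \<open>a > 0\<close> by simp
    also have "\<dots> = \<bar>(p k - p l) $ i\<bar>"
      using \<open>a > 0\<close> by (simp add: p_def abs_mult right_diff_distrib[symmetric])
    also have "\<dots> \<le> dist (p k) (p l)"
      unfolding dist_norm by (rule component_le_norm_cart)
    finally show ?thesis .
  qed
  have inj: "inj_on p P"
    by (rule inj_onI) (use sep \<open>a > 0\<close> in force)
  show ?thesis
  proof (rule that[of "p ` P"])
    show "finite (p ` P)" unfolding P_def by (intro finite_imageI finite_PiE) auto
    show "p ` P \<subseteq> cball z0 \<rho>"
    proof safe
      fix k assume k: "k \<in> P"
      have "dist z0 (p k) = norm (\<chi> i. a * real (k i) :: real ^ 'd)"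
        by (simp add: p_def dist_norm norm_minus_commute)
      also have "\<dots> \<le> (\<Sum>i\<in>UNIV. \<bar>(\<chi> i. a * real (k i) :: real ^ 'd) $ i\<bar>)"
        by (rule norm_le_l1_cart)
      also have "\<dots> \<le> (\<Sum>i\<in>(UNIV::'d set). a * real m)"
      proof (rule sum_mono)
        fix i
        have "k i < m" using k by (auto simp: P_def)
        then show "\<bar>(\<chi> i. a * real (k i) :: real ^ 'd) $ i\<bar> \<le> a * real m"
          using \<open>a > 0\<close> by simp
      qed
      also have "\<dots> = real CARD('d) * a * real m" by simp
      also have "\<dots> \<le> real CARD('d) * a * x"
        using m \<open>a > 0\<close> by (intro mult_left_mono) auto
      also have "\<dots> = \<rho>" using \<open>a > 0\<close> by (simp add: x_def)
      finally show "p k \<in> cball z0 \<rho>" by simp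
    qed
    show "a \<le> dist y z" if "y \<in> p ` P" "z \<in> p ` P" "y \<noteq> z" for y z
      using that sep by (metis imageE)
    have "(\<rho> / (2 * real CARD('d) * a)) ^ CARD('d) = (x / 2) ^ CARD('d)"
      by (simp add: x_def mult_ac)
    also have "\<dots> \<le> real m ^ CARD('d)"
      using m x by (intro power_mono) auto
    also have "\<dots> = real (card (p ` P))"
      using inj by (simp add: card_image P_def card_PiE)
    finally show "(\<rho> / (2 * real CARD('d) * a)) ^ CARD('d) \<le> real (card (p ` P))" .
  qed
qed

section \<open>Deviations of the kernel density estimate\<close>

text \<open>
  If no observation falls into \<open>z - s *\<^sub>R A\<close>, the estimate at \<open>z\<close> loses the contribution of that
  set, whose mean is about \<open>f0 * \<theta>\<close>, and by \<open>avoiding_concentration\<close> the other contributions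
  are still likely to be near their mean \<open>f0 * (1 - \<theta>)\<close>. The cost is the avoidance probability,
  which is about \<open>exp (- f0 * a * v * n)\<close> with \<open>a\<close> the measure of \<open>A\<close> and \<open>v\<close> the bandwidth; the
  factors \<open>4\<close> and \<open>1 / 2\<close> absorb the approximations.
\<close>

lemma cell_deviation_probability:
  fixes \<mu> :: "'a::euclidean_space measure" and f K :: "'a \<Rightarrow> real" and I :: "'i set"
  assumes \<mu>: "prob_space \<mu>" "sets \<mu> = sets borel"
    and dens: "\<And>S. S \<in> sets borel \<Longrightarrow> S \<subseteq> U \<Longrightarrow> emeasure \<mu> S = (\<integral>\<^sup>+x\<in>S. ennreal (f x) \<partial>lborel)"
    and U: "open U" and f: "continuous_on U f" and pos: "\<And>x. x \<in> U \<Longrightarrow> f x > 0"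
    and K: "integrable lborel K" "integral\<^sup>L lborel K = 1" and KB: "\<And>u. \<bar>K u\<bar> \<le> B"
    and KR: "\<And>u. K u \<noteq> 0 \<Longrightarrow> norm u \<le> R" and "0 \<le> R"
    and A: "A \<in> sets borel" "A \<subseteq> cball 0 R"
    and \<theta>: "\<theta> = (\<integral>u. indicator A u * K u \<partial>lborel)" and L: "L = (\<integral>u. \<bar>K u\<bar> \<partial>lborel)"
    and a: "a = measure lborel A"
    and "s > 0" and \<tau>: "0 < \<tau>" "\<tau> \<le> f0"
    and near: "\<And>u. norm u \<le> R \<Longrightarrow> z - s *\<^sub>R u \<in> U \<and> \<bar>f (z - s *\<^sub>R u) - f0\<bar> \<le> \<tau>"
    and I: "finite I" "I \<noteq> {}" and n: "n = real (card I)" and v: "v = s ^ DIM('a)"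
    and small: "2 * f0 * a * v \<le> 1 / 2" "4 * f0 * a * v * (f0 * \<bar>1 - \<theta>\<bar> + \<tau> * L) \<le> \<tau>"
    and many: "8 * f0 * B * L \<le> n * v * \<tau>\<^sup>2"
    and \<epsilon>: "\<tau> * (3 + L) + \<epsilon> < f0 * \<bar>\<theta>\<bar>"
  shows "exp (- (4 * f0 * a * v * n)) / 2 \<le> measure (PiM I (\<lambda>_. \<mu>)) {x \<in> space (PiM I (\<lambda>_. \<mu>)).
          (\<Sum>i\<in>I. K ((z - x i) /\<^sub>R s)) \<in> {t. \<epsilon> < \<bar>1 / (n * v) * t - f z\<bar>}}"
proof -
  note [measurable_cong] = \<mu>(2)
  interpret mu: prob_space \<mu> by fact
  interpret P: prob_space "PiM I (\<lambda>_. \<mu>)" by (intro prob_space_PiM \<mu>(1))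
  have Km[measurable]: "K \<in> borel_measurable borel"
    using K(1) by (simp add: borel_measurable_integrable)
  note [measurable] = A(1)
  have loc: "\<bar>(\<integral>x. g ((z - x) /\<^sub>R s) \<partial>\<mu>) - v * (f0 * integral\<^sup>L lborel g)\<bar>
      \<le> v * (\<tau> * (\<integral>u. \<bar>g u\<bar> \<partial>lborel))"
    if "integrable lborel g" "\<And>u. g u \<noteq> 0 \<Longrightarrow> norm u \<le> R" for g :: "'a \<Rightarrow> real"
    unfolding v by (rule local_expectation[where R = R and U = U and f = f])
      (use \<mu>(2) dens U f pos that \<open>s > 0\<close> near in auto)
  have f0: "f0 > 0" using \<tau> by simp
  have n0: "n > 0" using I by (simp add: n card_gt_0_iff)
  have v0: "v > 0" using \<open>s > 0\<close> by (simp add: v)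
  have a0: "a \<ge> 0" by (simp add: a)
  have L0: "L \<ge> 0" unfolding L by simp
  have B0: "B \<ge> 0" using KB[of 0] by linarith
  define Q where "Q = {x. (z - x) /\<^sub>R s \<in> A}"
  define G where "G = (\<lambda>u. indicator (- A) u * K u)"
  define X where "X = (\<lambda>x. G ((z - x) /\<^sub>R s))"
  have Gm[measurable]: "G \<in> borel_measurable borel" unfolding G_def by measurable
  have Q[measurable]: "Q \<in> sets borel" unfolding Q_def by measurable
  have Xm[measurable]: "X \<in> borel_measurable borel" unfolding X_def by measurable
  have GK: "\<bar>G u\<bar> \<le> \<bar>K u\<bar>" for u by (simp add: G_def indicator_def)
  have GB: "\<bar>G u\<bar> \<le> B" for u using GK[of u] KB[of u] by simp
  have Gint: "integrable lborel G"
    by (rule Bochner_Integration.integrable_bound[OF K(1)]) (use GK in auto)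
  have AKint: "integrable lborel (\<lambda>u. indicator A u * K u)"
    using integrable_mult_indicator[OF _ K(1), of A] by simp
  have GR: "norm u \<le> R" if "G u \<noteq> 0" for u
    using that KR[of u] by (auto simp: G_def)
  have EG: "integral\<^sup>L lborel G = 1 - \<theta>"
  proof -
    have "integral\<^sup>L lborel G = (\<integral>u. K u - indicator A u * K u \<partial>lborel)"
      by (rule Bochner_Integration.integral_cong) (auto simp: G_def indicator_def)
    then show ?thesis using K AKint by (simp add: \<theta>)
  qed
  have EGabs: "(\<integral>u. \<bar>G u\<bar> \<partial>lborel) \<le> L"
    unfolding L by (rule integral_mono) (use Gint K GK in auto)
  have G2: "(G u)\<^sup>2 \<le> B * \<bar>G u\<bar>" for u
    using mult_right_mono[OF GB[of u], of "\<bar>G u\<bar>"] by (simp add: power2_eq_square abs_mult_self_eq)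
  have G2int: "integrable lborel (\<lambda>u. (G u)\<^sup>2)"
  proof (rule Bochner_Integration.integrable_bound)
    show "integrable lborel (\<lambda>u. B * \<bar>G u\<bar>)" using Gint by simp
    show "AE u in lborel. norm ((G u)\<^sup>2) \<le> norm (B * \<bar>G u\<bar>)"
      using G2 B0 by (intro AE_I2) (simp add: abs_mult)
  qed measurable
  have EG2: "(\<integral>u. (G u)\<^sup>2 \<partial>lborel) \<le> B * L"
  proof -
    have "(\<integral>u. (G u)\<^sup>2 \<partial>lborel) \<le> (\<integral>u. B * \<bar>G u\<bar> \<partial>lborel)"
      by (rule integral_mono) (use G2int Gint G2 in auto)
    also have "\<dots> \<le> B * L" using EGabs B0 by (simp add: mult_left_mono)
    finally show ?thesis .
  qed
  have aint: "integrable lborel (indicator A :: 'a \<Rightarrow> real)"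
    using A(1) emeasure_bounded_finite[OF bounded_subset[OF bounded_cball A(2)]] by simp
  have AR: "norm u \<le> R" if "indicator A u \<noteq> (0::real)" for u
    using that A(2) by (auto simp: indicator_def split: if_splits)
  define p where "p = measure \<mu> Q"
  have p_le: "p \<le> 2 * f0 * a * v"
  proof -
    have "p = (\<integral>x. indicator Q x \<partial>\<mu>)" by (simp add: p_def \<mu>(2)[THEN sets_eq_imp_space_eq])
    also have "\<dots> = (\<integral>x. indicator A ((z - x) /\<^sub>R s) \<partial>\<mu>)"
      by (rule Bochner_Integration.integral_cong) (auto simp: Q_def indicator_def)
    finally have "\<bar>p - v * (f0 * a)\<bar> \<le> v * (\<tau> * a)"
      using loc[OF aint AR] by (simp add: a)
    then have "p \<le> v * a * (f0 + \<tau>)" by (simp add: algebra_simps)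
    also have "\<dots> \<le> v * a * (2 * f0)" using \<tau> v0 a0 by (intro mult_left_mono) auto
    finally show ?thesis by (simp add: mult_ac)
  qed
  have p0: "0 \<le> p" "p \<le> 1 / 2" using p_le small by (auto simp: p_def)
  define m where "m = integral\<^sup>L \<mu> X"
  have m_near: "\<bar>m - v * (f0 * (1 - \<theta>))\<bar> \<le> v * (\<tau> * L)"
  proof -
    have "\<bar>m - v * (f0 * (1 - \<theta>))\<bar> \<le> v * (\<tau> * (\<integral>u. \<bar>G u\<bar> \<partial>lborel))"
      using loc[OF Gint GR] by (simp add: m_def X_def EG)
    also have "\<dots> \<le> v * (\<tau> * L)"
      using EGabs v0 \<tau> by (intro mult_left_mono) auto
    finally show ?thesis .
  qed
  have X2: "(\<integral>x. (X x)\<^sup>2 \<partial>\<mu>) \<le> 2 * f0 * v * B * L"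
  proof -
    have "\<bar>(\<integral>x. (X x)\<^sup>2 \<partial>\<mu>) - v * (f0 * (\<integral>u. (G u)\<^sup>2 \<partial>lborel))\<bar> \<le> v * (\<tau> * (\<integral>u. (G u)\<^sup>2 \<partial>lborel))"
      using loc[OF G2int] GR by (simp add: X_def)
    then have "(\<integral>x. (X x)\<^sup>2 \<partial>\<mu>) \<le> v * (f0 + \<tau>) * (\<integral>u. (G u)\<^sup>2 \<partial>lborel)"
      by (simp add: algebra_simps)
    also have "\<dots> \<le> v * (2 * f0) * (B * L)"
      using EG2 v0 \<tau> by (intro mult_mono) auto
    finally show ?thesis by (simp add: mult_ac)
  qed
  \<comment> \<open>\<open>m'\<close> is the mean of \<open>X\<close> conditionally on the complement of \<open>Q\<close>.\<close>
  define m' where "m' = m / (1 - p)"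
  define r where "r = n * v * \<tau>"
  have r0: "r > 0" using n0 v0 \<tau> by (simp add: r_def)
  let ?F = "{x \<in> space (PiM I (\<lambda>_. \<mu>)). (\<forall>i\<in>I. x i \<notin> Q) \<and> \<bar>(\<Sum>i\<in>I. X (x i)) - n * m'\<bar> \<le> r}"
  let ?T = "{x \<in> space (PiM I (\<lambda>_. \<mu>)). (\<Sum>i\<in>I. K ((z - x i) /\<^sub>R s)) \<in> {t. \<epsilon> < \<bar>1 / (n * v) * t - f z\<bar>}}"
  have T_m: "?T \<in> sets (PiM I (\<lambda>_. \<mu>))"
    using I(1) by measurable
  have half: "n * (\<integral>x. (X x)\<^sup>2 \<partial>\<mu>) / ((1 - p) * r\<^sup>2) \<le> 1 / 2"
  proof -
    have "n * (\<integral>x. (X x)\<^sup>2 \<partial>\<mu>) / ((1 - p) * r\<^sup>2) \<le> n * (2 * f0 * v * B * L) / ((1 / 2) * r\<^sup>2)"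
      using X2 n0 p0 r0 f0 v0 B0 L0 by (intro frac_le mult_left_mono mult_right_mono mult_nonneg_nonneg) auto
    also have "\<dots> = (n * v) * (4 * f0 * B * L) / r\<^sup>2" by simp
    also have "\<dots> \<le> (n * v) * (n * v * \<tau>\<^sup>2 / 2) / r\<^sup>2"
      using many n0 v0 by (intro divide_right_mono mult_left_mono) auto
    also have "\<dots> = 1 / 2"
      using n0 v0 \<tau> by (simp add: r_def power2_eq_square)
    finally show ?thesis .
  qed
  have "exp (- (4 * f0 * a * v * n)) / 2 \<le> (1 - p) ^ card I * (1 / 2)"
  proof -
    have "- (2 * p) \<le> - p - 2 * p\<^sup>2"
      using p0 mult_left_mono[of p "1/2" p] by (simp add: power2_eq_square)
    also have "\<dots> \<le> ln (1 - p)" by (rule ln_one_minus_pos_lower_bound) (use p0 in auto)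
    finally have "exp (- (2 * p)) \<le> 1 - p" using p0 by (simp add: ln_ge_iff)
    then have "exp (- (2 * p)) ^ card I \<le> (1 - p) ^ card I" by (rule power_mono) simp
    moreover have "exp (- (4 * f0 * a * v * n)) \<le> exp (- (2 * p)) ^ card I"
      using p_le n0 mult_left_mono[OF p_le, of "2 * n"]
      by (simp add: exp_of_nat_mult[symmetric] n[symmetric] mult_ac)
    ultimately show ?thesis by simp
  qed
  also have "\<dots> \<le> (1 - p) ^ card I * (1 - n * (\<integral>x. (X x)\<^sup>2 \<partial>\<mu>) / ((1 - p) * r\<^sup>2))"
    using half p0 by (intro mult_left_mono) auto
  also have "\<dots> \<le> P.prob ?F"
    unfolding n
  proof (rule avoiding_concentration[OF \<mu>(1) I])
    show "X \<in> borel_measurable \<mu>" "Q \<in> sets \<mu>" by measurable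
    show "\<bar>X x\<bar> \<le> B" for x using GB by (simp add: X_def)
    show "X x = 0" if "x \<in> Q" for x using that by (simp add: X_def G_def Q_def)
    show "p = measure \<mu> Q" by (rule p_def)
    show "m' = integral\<^sup>L \<mu> X / (1 - p)" by (simp add: m'_def m_def)
  qed (use p0 r0 in auto)
  also have "\<dots> \<le> P.prob ?T"
  proof (rule P.finite_measure_mono[OF _ T_m], safe)
    fix x assume x: "\<forall>i\<in>I. x i \<notin> Q" and dev: "\<bar>(\<Sum>i\<in>I. X (x i)) - n * m'\<bar> \<le> r"
    let ?S = "\<Sum>i\<in>I. K ((z - x i) /\<^sub>R s)"
    have "?S = (\<Sum>i\<in>I. X (x i))"
      by (rule sum.cong) (use x in \<open>auto simp: X_def G_def Q_def\<close>)
    with dev have "\<bar>?S - n * m'\<bar> \<le> (n * v) * \<tau>" by (simp add: r_def)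
    moreover have "1 / (n * v) * ?S - m' / v = (?S - n * m') / (n * v)"
      using n0 v0 by (simp add: field_simps)
    ultimately have 1: "\<bar>1 / (n * v) * ?S - m' / v\<bar> \<le> \<tau>"
      using n0 v0 by (simp add: abs_divide divide_le_eq mult_ac)
    have 2: "\<bar>m / v - f0 * (1 - \<theta>)\<bar> \<le> \<tau> * L"
    proof -
      have "m / v - f0 * (1 - \<theta>) = (m - v * (f0 * (1 - \<theta>))) / v" using v0 by (simp add: field_simps)
      then show ?thesis using m_near v0 by (simp add: abs_divide divide_le_eq mult_ac)
    qed
    have 3: "\<bar>m' / v - m / v\<bar> \<le> \<tau>"
    proof -
      have "m' / v - m / v = (m / v) * (p / (1 - p))"
        using v0 p0 by (simp add: m'_def field_simps)
      then have "\<bar>m' / v - m / v\<bar> = \<bar>m / v\<bar> * (p / (1 - p))"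
        using p0 by (simp add: abs_mult)
      also have "\<dots> \<le> (f0 * \<bar>1 - \<theta>\<bar> + \<tau> * L) * (2 * (2 * f0 * a * v))"
      proof (rule mult_mono)
        have "\<bar>f0 * (1 - \<theta>)\<bar> = f0 * \<bar>1 - \<theta>\<bar>" using f0 by (simp add: abs_mult)
        then show "\<bar>m / v\<bar> \<le> f0 * \<bar>1 - \<theta>\<bar> + \<tau> * L" using 2 by linarith
        have "p / (1 - p) \<le> p / (1 / 2)" using p0 by (intro frac_le) auto
        then show "p / (1 - p) \<le> 2 * (2 * f0 * a * v)" using p_le by simp
      qed (use p0 f0 L0 \<tau> in auto)
      also have "\<dots> \<le> \<tau>" using small(2) by (simp add: mult_ac)
      finally show ?thesis .
    qed
    have 4: "\<bar>f z - f0\<bar> \<le> \<tau>" using near[of 0] \<open>0 \<le> R\<close> by simp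
    have "f0 * \<bar>\<theta>\<bar> = \<bar>f0 * (1 - \<theta>) - f0\<bar>" using f0 by (simp add: abs_mult algebra_simps)
    with 1 2 3 4 \<epsilon> show "\<epsilon> < \<bar>1 / (n * v) * ?S - f z\<bar>"
      by (simp add: algebra_simps)
  qed
  finally show ?thesis .
qed

text \<open>
  When \<open>n * h n\<close> is of order \<open>ln n\<close>, the avoidance probability of one cell is a negative power of
  \<open>n\<close> whose exponent is proportional to the measure of \<open>A\<close>. Choosing that measure small makes the
  power \<open>n powr (- 1 / 10)\<close>. As there are about \<open>1 / h n\<close> disjoint cells, which is of order
  \<open>n / ln n\<close>, the expected number of cells with a deviation is of order \<open>n powr (9 / 10) / ln n\<close>,
  well above the fluctuation scale \<open>sqrt n\<close> of \<open>prob_no_cell_event_le\<close>.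
\<close>

lemma kernel_estimate_deviates_with_high_probability:
  fixes \<mu> :: "(real ^ 'd) measure" and f K :: "real ^ 'd \<Rightarrow> real" and h :: "nat \<Rightarrow> real"
  assumes \<mu>: "prob_space \<mu>" "sets \<mu> = sets borel"
    and dens: "\<And>S. S \<in> sets borel \<Longrightarrow> S \<subseteq> U \<Longrightarrow> emeasure \<mu> S = (\<integral>\<^sup>+x\<in>S. ennreal (f x) \<partial>lborel)"
    and U: "open U" and f: "continuous_on U f" and pos: "\<And>x. x \<in> U \<Longrightarrow> f x > 0"
    and K: "integrable lborel K" "integral\<^sup>L lborel K = 1" and KB: "\<And>u. \<bar>K u\<bar> \<le> B"
    and KR: "\<And>u. K u \<noteq> 0 \<Longrightarrow> norm u \<le> R" and R: "R > 0"
    and h: "\<And>n. n \<ge> 1 \<Longrightarrow> h n > 0" "h \<longlonglongrightarrow> 0"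
    and nh: "filterlim (\<lambda>n. real n * h n) at_top sequentially"
      "(\<lambda>n. real n * h n / ln (real n)) \<longlonglongrightarrow> c" and c: "c > 0"
    and z0: "z0 \<in> U" and "\<rho> > 0"
  obtains \<epsilon> \<kappa> where "\<epsilon> > 0" "\<kappa> > 0"
    "\<forall>\<^sub>F n in sequentially. \<exists>J. finite J \<and> J \<subseteq> cball z0 \<rho> \<and>
      measure (PiM {1..n} (\<lambda>_. \<mu>)) {x \<in> space (PiM {1..n} (\<lambda>_. \<mu>)). \<forall>z\<in>J. \<bar>kde K x n z (h n) - f z\<bar> \<le> \<epsilon>}
        \<le> exp (- \<kappa> * real n powr (4/5) / (ln (real n))\<^sup>2)"
proof -
  note [measurable_cong] = \<mu>(2)
  interpret mu: prob_space \<mu> by fact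
  have Km[measurable]: "K \<in> borel_measurable borel"
    using K(1) by (simp add: borel_measurable_integrable)
  let ?d = "real CARD('d)"
  define L where "L = (\<integral>u. \<bar>K u\<bar> \<partial>lborel)"
  have L0: "L \<ge> 0" unfolding L_def by simp
  define f0 where "f0 = f z0"
  have f0: "f0 > 0" using pos z0 by (simp add: f0_def)
  \<comment> \<open>Eventually \<open>n * h n \<le> 2 * c * ln n\<close>, so the factor \<open>exp (- (4 * f0 * a * h n * n))\<close> of the
     cell bound is at least \<open>n powr (- 8 * f0 * a * c)\<close>; the constant \<open>80\<close> makes this exponent
     at least \<open>- 1 / 10\<close>.\<close>
  obtain A where A: "A \<in> sets borel" "A \<subseteq> cball 0 R" "measure lborel A \<le> 1 / (80 * f0 * c)"
    and \<theta>0: "(\<integral>u. indicator A u * K u \<partial>lborel) \<noteq> 0"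
    by (rule small_set_carrying_mass[OF K(1) _ KR, of "1 / (80 * f0 * c)"]) (use K(2) f0 c in auto)
  define \<theta> where "\<theta> = (\<integral>u. indicator A u * K u \<partial>lborel)"
  define a where "a = measure lborel A"
  have a: "0 \<le> a" "a \<le> 1 / (80 * f0 * c)" using A(3) by (auto simp: a_def)
  define \<epsilon> where "\<epsilon> = f0 * \<bar>\<theta>\<bar> / 2"
  have \<epsilon>: "\<epsilon> > 0" using f0 \<theta>0 by (simp add: \<epsilon>_def \<theta>_def)
  define \<tau> where "\<tau> = min f0 (\<epsilon> / 2 / (3 + L))"
  have \<tau>: "0 < \<tau>" "\<tau> \<le> f0" using f0 \<epsilon> L0 by (auto simp: \<tau>_def)
  have "\<tau> * (3 + L) \<le> \<epsilon> / 2 / (3 + L) * (3 + L)"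
    using L0 by (intro mult_right_mono) (auto simp: \<tau>_def)
  also have "\<epsilon> / 2 / (3 + L) * (3 + L) = \<epsilon> / 2"
  proof -
    have "3 + L \<noteq> 0" using L0 by simp
    then show ?thesis by (rule iffD1[OF nonzero_eq_divide_eq refl])
  qed
  also have "\<dots> < \<epsilon>" using \<epsilon> by simp
  finally have \<tau>\<epsilon>: "\<tau> * (3 + L) + \<epsilon> < f0 * \<bar>\<theta>\<bar>" by (simp add: \<epsilon>_def)
  have "isCont f z0"
    using f U z0 by (simp add: continuous_on_eq_continuous_at)
  then have "\<forall>\<^sub>F x in at z0. dist (f x) (f z0) < \<tau>"
    using \<tau>(1) unfolding isCont_def by (rule tendstoD)
  then obtain d1 where d1: "d1 > 0" "\<And>x. x \<noteq> z0 \<Longrightarrow> dist x z0 < d1 \<Longrightarrow> dist (f x) (f z0) < \<tau>"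
    unfolding eventually_at by blast
  obtain d2 where d2: "d2 > 0" "ball z0 d2 \<subseteq> U"
    using U z0 by (meson openE)
  define d where "d = min (min d1 d2) \<rho> / 2"
  have d: "d > 0" "d \<le> \<rho>" using d1 d2 \<open>\<rho> > 0\<close> by (auto simp: d_def)
  have near0: "x \<in> U \<and> \<bar>f x - f0\<bar> \<le> \<tau>" if "dist z0 x \<le> d" for x
  proof -
    have "dist x z0 < d1" "x \<in> ball z0 d2"
      using that d1(1) d2(1) \<open>\<rho> > 0\<close> by (auto simp: d_def dist_commute)
    then show ?thesis using d1(2)[of x] d2(2) \<tau>(1) by (cases "x = z0") (auto simp: dist_real_def f0_def)
  qed
  define s where "s = (\<lambda>n. h n powr (1 / ?d))"
  have s0: "s \<longlonglongrightarrow> 0"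
    unfolding s_def
  proof (rule tendsto_zero_powrI[OF h(2) tendsto_const])
    show "\<forall>\<^sub>F n in sequentially. 0 \<le> h n"
      using eventually_ge_at_top[of 1] by eventually_elim (use h(1) in force)
  qed auto
  define \<kappa> where "\<kappa> = ((d / (12 * ?d * R)) ^ CARD('d))\<^sup>2 / (128 * c\<^sup>2)"
  have \<kappa>: "\<kappa> > 0" using d R c by (simp add: \<kappa>_def)
  have "\<forall>\<^sub>F n in sequentially. n \<ge> 2"
    by (rule eventually_ge_at_top)
  moreover have "\<forall>\<^sub>F n in sequentially. s n * R < d / 2"
    using tendsto_mult_right[OF s0, of R] d by (intro order_tendstoD) auto
  moreover have "\<forall>\<^sub>F n in sequentially. ?d * (3 * R * s n) < d / 2"
    using tendsto_mult_left[OF s0, of "?d * (3 * R)"] d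
    by (intro order_tendstoD[where y = 0]) (auto simp: mult_ac)
  moreover have "\<forall>\<^sub>F n in sequentially. 2 * f0 * a * h n < 1 / 2"
    using tendsto_mult_left[OF h(2), of "2 * f0 * a"] by (intro order_tendstoD) auto
  moreover have "\<forall>\<^sub>F n in sequentially. (4 * f0 * a * (f0 * \<bar>1 - \<theta>\<bar> + \<tau> * L)) * h n < \<tau>"
    using tendsto_mult_left[OF h(2), of "4 * f0 * a * (f0 * \<bar>1 - \<theta>\<bar> + \<tau> * L)"] \<tau>(1)
    by (intro order_tendstoD) auto
  moreover have "\<forall>\<^sub>F n in sequentially. 8 * f0 * B * L / \<tau>\<^sup>2 \<le> real n * h n"
    using nh(1) by (simp add: filterlim_at_top)
  moreover have "\<forall>\<^sub>F n in sequentially. real n * h n / ln (real n) < 2 * c"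
    using nh(2) c by (intro order_tendstoD) auto
  ultimately have "\<forall>\<^sub>F n in sequentially. \<exists>J. finite J \<and> J \<subseteq> cball z0 \<rho> \<and>
      measure (PiM {1..n} (\<lambda>_. \<mu>)) {x \<in> space (PiM {1..n} (\<lambda>_. \<mu>)). \<forall>z\<in>J. \<bar>kde K x n z (h n) - f z\<bar> \<le> \<epsilon>}
        \<le> exp (- \<kappa> * real n powr (4/5) / (ln (real n))\<^sup>2)"
  proof eventually_elim
    case (elim n)
    let ?s = "s n" and ?v = "h n" and ?P = "PiM {1..n} (\<lambda>_. \<mu>)"
    have v0: "?v > 0" using h(1) elim(1) by simp
    have s_pos: "?s > 0" using v0 by (simp add: s_def)
    have sv: "?s ^ CARD('d) = ?v"
      unfolding s_def using v0 by (simp add: powr_realpow[symmetric] powr_powr)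
    have ln0: "ln (real n) > 0" using elim(1) by simp
    have nv: "real n * ?v \<le> 2 * c * ln (real n)"
      using elim(7) ln0 by (simp add: divide_less_eq)
    \<comment> \<open>The term of \<open>z\<close> depends on observations within \<open>R * s n\<close> of \<open>z\<close>, so any separation
       above \<open>2 * R * s n\<close> makes the cells disjoint.\<close>
    obtain J where J: "finite J" "J \<subseteq> cball z0 (d / 2)"
        "\<And>y z. y \<in> J \<Longrightarrow> z \<in> J \<Longrightarrow> y \<noteq> z \<Longrightarrow> 3 * R * ?s \<le> dist y z"
        "(d / 2 / (2 * ?d * (3 * R * ?s))) ^ CARD('d) \<le> real (card J)"
      by (rule separated_points[of "3 * R * ?s" "d / 2" z0]) (use R s_pos elim(3) in auto)
    have cell_ratio: "d / 2 / (2 * ?d * (3 * R * ?s)) = (d / (12 * ?d * R)) / ?s"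
      by simp
    have cardJ: "(d / (12 * ?d * R)) ^ CARD('d) / ?v \<le> real (card J)"
      using J(4) unfolding cell_ratio power_divide[of _ ?s] sv .
    define D where "D = (\<lambda>z. {t. \<epsilon> < \<bar>1 / (real n * ?v) * t - f z\<bar>})"
    define \<phi> where "\<phi> = (\<lambda>z x. K ((z - x) /\<^sub>R ?s))"
    define q where "q = real n powr (- 1 / 10) / 2"
    have cell: "q \<le> measure ?P {x \<in> space ?P. (\<Sum>i\<in>{1..n}. \<phi> z (x i)) \<in> D z}" if "z \<in> J" for z
    proof -
      have "8 * f0 * a * c \<le> 8 * f0 * (1 / (80 * f0 * c)) * c"
        using a f0 c by (intro mult_left_mono mult_right_mono) auto
      also have "\<dots> = 1 / 10" using f0 c by simp
      finally have "8 * f0 * a * c \<le> 1 / 10" .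
      have "4 * f0 * a * ?v * real n = 4 * f0 * a * (real n * ?v)" by simp
      also have "\<dots> \<le> 4 * f0 * a * (2 * c * ln (real n))"
        using nv f0 a by (intro mult_left_mono) auto
      also have "\<dots> = (8 * f0 * a * c) * ln (real n)" by simp
      also have "\<dots> \<le> 1 / 10 * ln (real n)"
        using \<open>8 * f0 * a * c \<le> 1 / 10\<close> ln0 by (intro mult_right_mono) auto
      finally have "4 * f0 * a * ?v * real n \<le> 1 / 10 * ln (real n)" .
      then have "q \<le> exp (- (4 * f0 * a * ?v * real n)) / 2"
        unfolding q_def powr_def using elim(1) by simp
      also have "\<dots> \<le> measure ?P {x \<in> space ?P.
          (\<Sum>i\<in>{1..n}. K ((z - x i) /\<^sub>R ?s)) \<in> {t. \<epsilon> < \<bar>1 / (real n * ?v) * t - f z\<bar>}}"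
      proof (rule cell_deviation_probability[OF \<mu> dens U f pos K KB KR _ A(1,2) \<theta>_def L_def a_def s_pos \<tau>])
        fix u :: "real ^ 'd" assume "norm u \<le> R"
        then have "dist z (z - ?s *\<^sub>R u) \<le> ?s * R"
          using s_pos by (simp add: dist_norm)
        moreover have "dist z0 z \<le> d / 2" using J(2) that by auto
        ultimately have "dist z0 (z - ?s *\<^sub>R u) \<le> d"
          using dist_triangle[of z0 "z - ?s *\<^sub>R u" z] elim(2) by linarith
        then show "z - ?s *\<^sub>R u \<in> U \<and> \<bar>f (z - ?s *\<^sub>R u) - f0\<bar> \<le> \<tau>" by (rule near0)
      next
        show "?v = ?s ^ DIM(real ^ 'd)" using sv by simp
        show "8 * f0 * B * L \<le> real n * ?v * \<tau>\<^sup>2"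
          using elim(6) \<tau>(1) by (simp add: divide_le_eq)
        show "4 * f0 * a * ?v * (f0 * \<bar>1 - \<theta>\<bar> + \<tau> * L) \<le> \<tau>"
          using elim(5) by (simp add: mult_ac)
      qed (use elim(1,4) R \<tau>\<epsilon> in auto)
      finally show ?thesis unfolding \<phi>_def D_def .
    qed
    have "J \<noteq> {}"
    proof
      assume "J = {}"
      moreover have "(d / (12 * ?d * R)) ^ CARD('d) / ?v > 0" using d R v0 by simp
      ultimately show False using cardJ by simp
    qed
    have q0: "q > 0" using elim(1) by (simp add: q_def)
    have "measure ?P {x \<in> space ?P. \<forall>z\<in>J. (\<Sum>i\<in>{1..n}. \<phi> z (x i)) \<notin> D z}
        \<le> exp (- (q * real (card J))\<^sup>2 / (8 * real (card {1..n})))"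
    proof (rule prob_no_cell_event_le[OF \<mu>(1) _ _ J(1) \<open>J \<noteq> {}\<close>])
      show "\<phi> z \<in> borel_measurable \<mu>" for z unfolding \<phi>_def by measurable
      show "D z \<in> sets borel" for z unfolding D_def by measurable
      fix x y z assume y: "y \<in> J" and z: "z \<in> J" and "\<phi> y x \<noteq> 0" "\<phi> z x \<noteq> 0"
      then have "norm ((y - x) /\<^sub>R ?s) \<le> R" "norm ((z - x) /\<^sub>R ?s) \<le> R"
        by (auto simp: \<phi>_def simp del: norm_scaleR intro: KR)
      then have "dist y x \<le> R * ?s" "dist z x \<le> R * ?s"
        using s_pos by (simp_all add: dist_norm inverse_eq_divide pos_divide_le_eq)
      then have "dist y z \<le> 2 * (R * ?s)"
        using dist_triangle2[of y z x] by linarith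
      moreover have "R * ?s > 0" using R s_pos by simp
      ultimately have "dist y z < 3 * R * ?s" by linarith
      then show "y = z" using J(3)[OF y z] by linarith
    qed (use elim(1) q0 cell in auto)
    also have "{x \<in> space ?P. \<forall>z\<in>J. (\<Sum>i\<in>{1..n}. \<phi> z (x i)) \<notin> D z}
        = {x \<in> space ?P. \<forall>z\<in>J. \<bar>kde K x n z ?v - f z\<bar> \<le> \<epsilon>}"
      by (auto simp: kde_def \<phi>_def D_def s_def not_less)
    also have "exp (- (q * real (card J))\<^sup>2 / (8 * real (card {1..n}))) \<le> exp (- \<kappa> * real n powr (4/5) / (ln (real n))\<^sup>2)"
    proof -
      define w where "w = (d / (12 * ?d * R)) ^ CARD('d)"
      have w: "w > 0" using d R by (simp add: w_def)
      have "w * real n / (2 * c * ln (real n)) \<le> w * real n / (real n * ?v)"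
        using nv v0 elim(1) w by (intro divide_left_mono) (auto intro!: mult_pos_pos c ln0)
      also have "\<dots> \<le> real (card J)" using cardJ elim(1) by (simp add: w_def)
      finally have "q * (w * real n / (2 * c * ln (real n))) \<le> q * real (card J)"
        using q0 by (intro mult_left_mono) auto
      then have le: "(q * (w * real n / (2 * c * ln (real n))))\<^sup>2 / (8 * real n) \<le> (q * real (card J))\<^sup>2 / (8 * real n)"
        using q0 w c ln0 by (intro divide_right_mono power_mono) auto
      have "(real n powr (- 1 / 10))\<^sup>2 * real n = real n powr (4 / 5)"
      proof -
        have "(real n powr (- 1 / 10))\<^sup>2 * real n = real n powr (- 1 / 10) * real n powr (- 1 / 10) * real n powr 1"
          using elim(1) by (simp add: power2_eq_square)
        also have "\<dots> = real n powr (4 / 5)"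
          by (simp only: powr_add[symmetric]) simp
        finally show ?thesis .
      qed
      then have "\<kappa> * real n powr (4/5) / (ln (real n))\<^sup>2 = (q * (w * real n / (2 * c * ln (real n))))\<^sup>2 / (8 * real n)"
        unfolding \<kappa>_def w_def[symmetric] q_def using elim(1) c ln0
        by (simp add: field_simps power2_eq_square)
      with le show ?thesis by simp
    qed
    finally show ?case
      using J(1,2) d by (intro exI[of _ J]) auto
  qed
  with that \<epsilon> \<kappa> show thesis by blast
qed

theorem mainTheorem2:
  fixes M :: "'a measure"
    and Z :: "nat \<Rightarrow> 'a \<Rightarrow> real ^ 'd"
    and f K :: "real ^ 'd \<Rightarrow> real"
    and U H :: "(real ^ 'd) set"
    and h :: "nat \<Rightarrow> real"
    and c :: real
  assumes "prob_space M"
    and "prob_space.indep_vars M (\<lambda>_. borel) Z {1..}"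
    and "\<And>i. i \<ge> 1 \<Longrightarrow> distr M borel (Z i) = distr M borel (Z 1)"
    and "open U"
    and "has_density_on M (Z 1) f U"
    and "continuous_on U f"
    and "\<And>x. x \<in> U \<Longrightarrow> f x > 0"
    and "kde_kernel K" and "compact_support K" and "bounded_variation K"
    and "\<And>n. n \<ge> 1 \<Longrightarrow> 0 < h n \<and> h n < 1"
    and "antimono_on {1..} h" and "h \<longlonglongrightarrow> 0"
    and "mono_on {1..} (\<lambda>n. real n * h n)"
    and "filterlim (\<lambda>n. real n * h n) at_top sequentially"
    and "(\<lambda>n. real n * h n / ln (real n)) \<longlonglongrightarrow> c" and "0 < c"
    and "compact H" and "H \<subseteq> U" and "interior H \<noteq> {}"
  shows "AE \<omega> in M. \<exists>\<epsilon>>0. \<exists>n0. \<forall>n\<ge>n0.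
           (SUP z\<in>H. ereal \<bar>kde K (\<lambda>i. Z i \<omega>) n z (h n) - f z\<bar>) > ereal \<epsilon>"
proof -
  interpret prob_space M by fact
  note Z_indep = assms(2) and Z_id = assms(3) and h_pos = assms(11)
  have Z_rv: "random_variable borel (Z i)" if "i \<ge> 1" for i
    using Z_indep that unfolding indep_vars_def by auto
  define \<mu> where "\<mu> = distr M borel (Z 1)"
  have \<mu>: "prob_space \<mu>" "sets \<mu> = sets borel"
    unfolding \<mu>_def using prob_space_distr[OF Z_rv[of 1]] by auto
  obtain B where KB: "\<And>u. \<bar>K u\<bar> \<le> B"
    using bounded_variation_imp_bounded \<open>bounded_variation K\<close> \<open>compact_support K\<close> by blast
  have K: "integrable lborel K" "integral\<^sup>L lborel K = 1"
    using \<open>kde_kernel K\<close> by (auto simp: kde_kernel_def)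
  obtain R where R: "R > 0" "\<And>u. K u \<noteq> 0 \<Longrightarrow> norm u \<le> R"
  proof -
    have "bounded {u. K u \<noteq> 0}"
      using \<open>compact_support K\<close> unfolding compact_support_def
      by (meson bounded_subset closure_subset compact_imp_bounded)
    then show thesis using that by (auto simp: bounded_pos)
  qed
  obtain z0 \<rho> where z0: "\<rho> > 0" "cball z0 \<rho> \<subseteq> H"
    using \<open>interior H \<noteq> {}\<close> mem_interior_cball by blast
  have "z0 \<in> cball z0 \<rho>" using z0(1) by simp
  with z0(2) \<open>H \<subseteq> U\<close> have "z0 \<in> U" by blast
  obtain \<epsilon> \<kappa> where \<epsilon>: "\<epsilon> > 0" and \<kappa>: "\<kappa> > 0" and
    ev: "\<forall>\<^sub>F n in sequentially. \<exists>J. finite J \<and> J \<subseteq> cball z0 \<rho> \<and>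
      measure (PiM {1..n} (\<lambda>_. \<mu>)) {x \<in> space (PiM {1..n} (\<lambda>_. \<mu>)). \<forall>z\<in>J. \<bar>kde K x n z (h n) - f z\<bar> \<le> \<epsilon>}
        \<le> exp (- \<kappa> * real n powr (4/5) / (ln (real n))\<^sup>2)"
  proof (rule kernel_estimate_deviates_with_high_probability[OF \<mu> _ \<open>open U\<close> \<open>continuous_on U f\<close> _ K KB R(2) R(1) _ _ _ _ _ \<open>z0 \<in> U\<close> z0(1), where h = h and c = c])
    show "emeasure \<mu> S = (\<integral>\<^sup>+x\<in>S. ennreal (f x) \<partial>lborel)" if "S \<in> sets borel" "S \<subseteq> U" for S
      using \<open>has_density_on M (Z 1) f U\<close> that unfolding has_density_on_def \<mu>_def by blast
  qed (use assms in auto)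
  define good where "good = (\<lambda>n J. finite J \<and> J \<subseteq> cball z0 \<rho> \<and>
      measure (PiM {1..n} (\<lambda>_. \<mu>)) {x \<in> space (PiM {1..n} (\<lambda>_. \<mu>)). \<forall>z\<in>J. \<bar>kde K x n z (h n) - f z\<bar> \<le> \<epsilon>}
        \<le> exp (- \<kappa> * real n powr (4/5) / (ln (real n))\<^sup>2))"
  from ev have "\<exists>n1. \<forall>n\<ge>n1. \<exists>J. good n J"
    unfolding eventually_sequentially good_def .
  then obtain n1 where "\<forall>n\<ge>n1. \<exists>J. good n J" by blast
  then obtain J where J_good: "\<And>n. n \<ge> n1 \<Longrightarrow> good n (J n)" by metis
  \<comment> \<open>The index \<open>0\<close> is excluded because the law of an empty sample is not covered by
     the characterisation of independence by product measures.\<close>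
  define n2 where "n2 = max n1 1"
  have good: "good n (J n)" if "n \<ge> n2" for n
    using J_good that by (simp add: n2_def)
  note J = good[unfolded good_def, THEN conjunct1] good[unfolded good_def, THEN conjunct2, THEN conjunct1]
    good[unfolded good_def, THEN conjunct2, THEN conjunct2]
  have Km[measurable]: "K \<in> borel_measurable borel"
    using K(1) by (simp add: borel_measurable_integrable)
  define N where "N = (\<lambda>n. if n \<ge> n2
    then {\<omega> \<in> space M. \<forall>z\<in>J n. \<bar>kde K (\<lambda>i. Z i \<omega>) n z (h n) - f z\<bar> \<le> \<epsilon>} else {})"
  have kde_m: "(\<lambda>\<omega>. kde K (\<lambda>i. Z i \<omega>) n z (h n)) \<in> borel_measurable M" for n z
  proof -
    have "(\<lambda>\<omega>. K ((z - Z i \<omega>) /\<^sub>R h n powr (1 / real CARD('d)))) \<in> borel_measurable M" if "i \<in> {1..n}" for i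
    proof -
      have [measurable]: "Z i \<in> borel_measurable M" using Z_rv that by simp
      show ?thesis by measurable
    qed
    then show ?thesis
      unfolding kde_def by (intro borel_measurable_times borel_measurable_const borel_measurable_sum)
  qed
  have N_m: "N n \<in> sets M" for n
  proof (cases "n \<ge> n2")
    case True
    have "{\<omega> \<in> space M. \<bar>kde K (\<lambda>i. Z i \<omega>) n z (h n) - f z\<bar> \<le> \<epsilon>} \<in> sets M" for z
      using kde_m[of n z] by measurable
    then have "{\<omega> \<in> space M. \<forall>z\<in>J n. \<bar>kde K (\<lambda>i. Z i \<omega>) n z (h n) - f z\<bar> \<le> \<epsilon>} \<in> sets M"
      by (cases "J n = {}") (auto intro!: sets.sets_Collect_finite_All' J(1)[OF True])
    then show ?thesis using True by (simp add: N_def)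
  qed (simp add: N_def)
  have N_prob: "prob (N n) \<le> exp (- \<kappa> * real n powr (4/5) / (ln (real n))\<^sup>2)" if n: "n \<ge> n2" for n
  proof -
    let ?P = "PiM {1..n} (\<lambda>_. \<mu>)" and ?Z = "\<lambda>\<omega>. \<lambda>i\<in>{1..n}. Z i \<omega>"
    have ne: "{1..n} \<noteq> {}" using n by (auto simp: n2_def)
    have Z_m: "?Z \<in> measurable M (PiM {1..n} (\<lambda>_. borel))"
      by (rule measurable_restrict) (use Z_rv in auto)
    have "indep_vars (\<lambda>_. borel) Z {1..n}"
      by (rule indep_vars_subset[OF Z_indep]) auto
    then have "distr M (PiM {1..n} (\<lambda>_. borel)) ?Z = PiM {1..n} (\<lambda>i. distr M borel (Z i))"
      using indep_vars_iff_distr_eq_PiM'[OF ne, of Z "\<lambda>_. borel"] Z_rv by auto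
    also have "\<dots> = ?P"
    proof (rule PiM_cong[OF refl])
      fix i assume "i \<in> {1..n}"
      then have "i \<ge> 1" by simp
      then show "distr M borel (Z i) = \<mu>" unfolding \<mu>_def by (rule Z_id)
    qed
    finally have law: "distr M (PiM {1..n} (\<lambda>_. borel)) ?Z = ?P" .
    let ?E = "{x \<in> space ?P. \<forall>z\<in>J n. \<bar>kde K x n z (h n) - f z\<bar> \<le> \<epsilon>}"
    have sets_P: "sets ?P = sets (PiM {1..n} (\<lambda>_. borel))"
      by (rule sets_PiM_cong) (simp_all add: \<mu>(2))
    have kde_P: "(\<lambda>x. kde K x n z (h n)) \<in> borel_measurable ?P" for z
    proof -
      note [measurable_cong] = \<mu>(2)
      show ?thesis unfolding kde_def by measurable
    qed
    have E_m: "?E \<in> sets (PiM {1..n} (\<lambda>_. borel))"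
      unfolding sets_P[symmetric] using kde_P J(1)[OF n] by measurable
    have kde_restrict: "kde K (?Z \<omega>) n z (h n) = kde K (\<lambda>i. Z i \<omega>) n z (h n)" for \<omega> z
      unfolding kde_def by simp
    have "measure ?P ?E = measure (distr M (PiM {1..n} (\<lambda>_. borel)) ?Z) ?E"
      by (simp only: law)
    also have "\<dots> = prob (?Z -` ?E \<inter> space M)"
      by (rule measure_distr[OF Z_m E_m])
    also have "?Z -` ?E \<inter> space M = N n"
    proof -
      have "?Z \<omega> \<in> space ?P" if "\<omega> \<in> space M" for \<omega>
        using measurable_space[OF Z_m that] sets_eq_imp_space_eq[OF sets_P] by simp
      then have "?Z -` ?E \<inter> space M = {\<omega> \<in> space M. \<forall>z\<in>J n. \<bar>kde K (?Z \<omega>) n z (h n) - f z\<bar> \<le> \<epsilon>}"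
        by blast
      then show ?thesis unfolding kde_restrict using n by (simp only: N_def if_True)
    qed
    finally show ?thesis using J(3)[OF n] by simp
  qed
  have "summable (\<lambda>n. prob (N n))"
  proof (rule summable_comparison_test_ev)
    have "(\<lambda>n::nat. exp (- \<kappa> * real n powr (4/5) / (ln (real n))\<^sup>2)) \<in> o(\<lambda>n. 1 / real n ^ 2)"
      using \<kappa> by real_asymp
    then have "\<forall>\<^sub>F n::nat in sequentially. norm (exp (- \<kappa> * real n powr (4/5) / (ln (real n))\<^sup>2)) \<le> 1 * norm (1 / real n ^ 2)"
      by (rule landau_o.smallD) simp
    then show "\<forall>\<^sub>F n in sequentially. norm (prob (N n)) \<le> 1 / real n ^ 2"
      using eventually_ge_at_top[of n2]
    proof eventually_elim
      case (elim n)
      then show ?case using N_prob[of n] by simp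
    qed
    show "summable (\<lambda>n. 1 / real n ^ 2)"
      using inverse_power_summable[of 2, where ?'a = real] by (simp add: field_simps)
  qed
  then have "AE \<omega> in M. \<forall>\<^sub>F n in sequentially. \<omega> \<in> space M - N n"
    by (intro borel_cantelli_AE1) (auto simp: N_m emeasure_eq_measure)
  then show ?thesis
  proof (rule AE_mp, intro AE_I2 impI)
    fix \<omega> assume "\<omega> \<in> space M" and "\<forall>\<^sub>F n in sequentially. \<omega> \<in> space M - N n"
    then obtain n3 where n3: "\<And>n. n \<ge> n3 \<Longrightarrow> \<omega> \<in> space M - N n"
      unfolding eventually_sequentially by blast
    have "(SUP z\<in>H. ereal \<bar>kde K (\<lambda>i. Z i \<omega>) n z (h n) - f z\<bar>) > ereal \<epsilon>" if n: "n \<ge> max n2 n3" for n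
    proof -
      obtain z where z: "z \<in> J n" "\<bar>kde K (\<lambda>i. Z i \<omega>) n z (h n) - f z\<bar> > \<epsilon>"
        using n3[of n] n by (auto simp: N_def not_le)
      then have "z \<in> H" using J(2)[of n] z0(2) n by auto
      with z(2) show ?thesis by (auto simp: less_SUP_iff)
    qed
    with \<epsilon> show "\<exists>\<epsilon>>0. \<exists>n0. \<forall>n\<ge>n0.
           (SUP z\<in>H. ereal \<bar>kde K (\<lambda>i. Z i \<omega>) n z (h n) - f z\<bar>) > ereal \<epsilon>"
      by blast
  qed
qed

end
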